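(* Let $(\check M^{2n},\check g,J)$ be an almost Hermitian manifold and $f\colon\mathbb R\to\mathbb R$ a strictly positive smooth function, and equip the warped product $M=\mathbb R\times_f\check M$ with its induced almost contact metric structure. Then the Reeb field $\xi$ is harmonic, i.e. $\tau(\xi)=0$, and the first harmonic section equation $\tau(\xi)+\tfrac12J\,T(\phi)=0$ is verified if and only if $\check M$ is a cosymplectic almost Hermitian manifold or $f$ is constant.
   Context: An almost contact metric structure on a Riemannian manifold $(M^{2n+1},g)$ consists of a $(1,1)$-tensor $\phi$, a unit vector field $\xi$ (the Reeb field) and its dual $1$-form $\eta=g(\xi,\cdot)$, with $\phi^2=-I+\eta\otimes\xi$ and $g(\phi X,\phi Y)=g(X,Y)-\eta(X)\eta(Y)$. Everything is smooth. $\nabla$ is the Levi-Civita connection; $\mathcal{D}=\operatorname{im}\phi=\ker\eta$; $J=\phi|_{\mathcal D}$; $\bar\nabla$ is the connection in $\mathcal{D}\to M$ given by $\bar\nabla_XY=(\nabla_XY)_{\mathcal D}$ (orthogonal projection), $X\in TM$, $Y$ a section of $\mathcal D$. $\nabla^2_{X,Y}=\nabla_X\nabla_Y-\nabla_{\nabla_XY}$. For a local orthonormal frame $(E_i)$ of $TM$ (sums over repeated indices): $\nabla^*\nabla\xi=-\nabla^2_{E_i,E_i}\xi$, $$\tau(\xi)=\nabla^*\nabla\xi-|\nabla\xi|^2\xi,\qquad T(\phi)=(\bar\nabla_{E_i}J)\big(\nabla_{E_i}\xi\big)$$ (note that $\nabla_X\xi\in\mathcal D$). The unit vector field $\xi$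 is harmonic if $\tau(\xi)=0$. The warped product $\mathbb R\times_f\check M$ is $\mathbb R\times\check M$ with metric $g=dt^2+f(t)^2\check g$. Its induced almost contact metric structure is given by $\xi=\partial_t$, $\mathcal D=T\check M$ equipped with the almost complex structure $J$ of $\check M$ (so $\phi\xi=0$ and $\phi|_{\mathcal D}=J$). An almost Hermitian manifold $(\check M,\check g,J)$ with Levi-Civita connection $\check\nabla$ is cosymplectic if its Kähler form is co-closed (equivalently $\sum_i(\check\nabla_{F_i}J)(F_i)=0$ for local orthonormal frames $(F_i)$). *)

theory Defs
  imports "HOL-Analysis.Analysis"
begin

section \<open>Smooth maps between open subsets of Euclidean spaces\<close>

primrec higher_differentiable_on ::
    "'e::euclidean_space set \<Rightarrow> ('e \<Rightarrow> 'b::real_normed_vector) \<Rightarrow> nat \<Rightarrow> bool" where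
  "higher_differentiable_on S f 0 \<longleftrightarrow> continuous_on S f"
| "higher_differentiable_on S f (Suc n) \<longleftrightarrow>
     (\<forall>x\<in>S. f differentiable (at x)) \<and>
     (\<forall>v. higher_differentiable_on S (\<lambda>x. frechet_derivative f (at x) v) n)"

text \<open>To be used for open \<open>S\<close> only.\<close>
definition smooth_on :: "'e::euclidean_space set \<Rightarrow> ('e \<Rightarrow> 'b::real_normed_vector) \<Rightarrow> bool" where
  "smooth_on S f \<longleftrightarrow> (\<forall>n. higher_differentiable_on S f n)"


section \<open>Smooth manifolds and tensor fields\<close>

text \<open>
  A manifold is a set \<open>M\<close> in a Hausdorff second countable space, with an indexed atlas of charts
  \<open>\<kappa> i : U i \<rightarrow> \<kappa> i ` U i\<close>, \<open>i \<in> I\<close>, onto open subsets of the model space \<open>'e\<close>; its dimension is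
  \<open>DIM('e)\<close>. The sets \<open>U i\<close> are open in the ambient type, hence so is \<open>M\<close>; taking \<open>M = UNIV\<close> covers
  every manifold.

  A tensor field is the family, indexed by the atlas, of its local expressions: for a vector
  field, \<open>X i x\<close> is the component vector, in the chart \<open>i\<close>, at the point with coordinates
  \<open>x \<in> \<kappa> i ` U i\<close>. Local expressions transform by the derivative of the coordinate changes.
\<close>

definition transition ::
    "('i \<Rightarrow> 'a set) \<Rightarrow> ('i \<Rightarrow> 'a \<Rightarrow> 'e) \<Rightarrow> 'i \<Rightarrow> 'i \<Rightarrow> 'e \<Rightarrow> 'e" where
  "transition U \<kappa> i j = \<kappa> j \<circ> inv_into (U i) (\<kappa> i)"

definition smooth_manifold ::
    "'a::{t2_space,second_countable_topology} set \<Rightarrow> 'i set \<Rightarrow> ('i \<Rightarrow> 'a set) \<Rightarrow>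
     ('i \<Rightarrow> 'a \<Rightarrow> 'e::euclidean_space) \<Rightarrow> bool" where
  "smooth_manifold M I U \<kappa> \<longleftrightarrow>
     M = (\<Union>i\<in>I. U i) \<and>
     (\<forall>i\<in>I. open (U i) \<and> open (\<kappa> i ` U i) \<and>
        homeomorphism (U i) (\<kappa> i ` U i) (\<kappa> i) (inv_into (U i) (\<kappa> i))) \<and>
     (\<forall>i\<in>I. \<forall>j\<in>I. smooth_on (\<kappa> i ` (U i \<inter> U j)) (transition U \<kappa> i j))"

definition inner_form :: "('e::euclidean_space \<Rightarrow> 'e \<Rightarrow> real) \<Rightarrow> bool" where
  "inner_form b \<longleftrightarrow> bilinear b \<and> (\<forall>u v. b u v = b v u) \<and> (\<forall>u. u \<noteq> 0 \<longrightarrow> b u u > 0)"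

definition riemannian_metric ::
    "'i set \<Rightarrow> ('i \<Rightarrow> 'a set) \<Rightarrow> ('i \<Rightarrow> 'a \<Rightarrow> 'e::euclidean_space) \<Rightarrow>
     ('i \<Rightarrow> 'e \<Rightarrow> 'e \<Rightarrow> 'e \<Rightarrow> real) \<Rightarrow> bool" where
  "riemannian_metric I U \<kappa> g \<longleftrightarrow>
     (\<forall>i\<in>I. \<forall>x\<in>\<kappa> i ` U i. inner_form (g i x)) \<and>
     (\<forall>i\<in>I. \<forall>u v. smooth_on (\<kappa> i ` U i) (\<lambda>x. g i x u v)) \<and>
     (\<forall>i\<in>I. \<forall>j\<in>I. \<forall>p\<in>U i \<inter> U j. \<forall>u v.
        let D = frechet_derivative (transition U \<kappa> i j) (at (\<kappa> i p))
        in g i (\<kappa> i p) u v = g j (\<kappa> j p) (D u) (D v))"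

definition endomorphism_field ::
    "'i set \<Rightarrow> ('i \<Rightarrow> 'a set) \<Rightarrow> ('i \<Rightarrow> 'a \<Rightarrow> 'e::euclidean_space) \<Rightarrow>
     ('i \<Rightarrow> 'e \<Rightarrow> 'e \<Rightarrow> 'e) \<Rightarrow> bool" where
  "endomorphism_field I U \<kappa> A \<longleftrightarrow>
     (\<forall>i\<in>I. \<forall>x\<in>\<kappa> i ` U i. linear (A i x)) \<and>
     (\<forall>i\<in>I. \<forall>u. smooth_on (\<kappa> i ` U i) (\<lambda>x. A i x u)) \<and>
     (\<forall>i\<in>I. \<forall>j\<in>I. \<forall>p\<in>U i \<inter> U j. \<forall>u.
        let D = frechet_derivative (transition U \<kappa> i j) (at (\<kappa> i p))
        in D (A i (\<kappa> i p) u) = A j (\<kappa> j p) (D u))"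

definition almost_hermitian_manifold ::
    "'a::{t2_space,second_countable_topology} set \<Rightarrow> 'i set \<Rightarrow> ('i \<Rightarrow> 'a set) \<Rightarrow>
     ('i \<Rightarrow> 'a \<Rightarrow> 'e::euclidean_space) \<Rightarrow>
     ('i \<Rightarrow> 'e \<Rightarrow> 'e \<Rightarrow> 'e \<Rightarrow> real) \<Rightarrow> ('i \<Rightarrow> 'e \<Rightarrow> 'e \<Rightarrow> 'e) \<Rightarrow> bool" where
  "almost_hermitian_manifold M I U \<kappa> g J \<longleftrightarrow>
     smooth_manifold M I U \<kappa> \<and> riemannian_metric I U \<kappa> g \<and> endomorphism_field I U \<kappa> J \<and>
     (\<forall>i\<in>I. \<forall>x\<in>\<kappa> i ` U i. \<forall>u v.
        J i x (J i x u) = - u \<and> g i x (J i x u) (J i x v) = g i x u v)"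


section \<open>The Levi-Civita connection in a chart\<close>

text \<open>
  From here on \<open>G\<close>, \<open>X\<close>, \<open>Y\<close>, \<open>Z\<close>, \<open>\<omega>\<close> are local expressions in one fixed chart.
  \<open>christoffel G x u v\<close> is the value at \<open>x\<close> of the covariant derivative, along \<open>u\<close>, of the field
  with constant components \<open>v\<close>. Fields with constant components commute, so the absence of torsion
  is the symmetry of \<open>B\<close>; the last conjunct is compatibility with the metric.
\<close>
definition christoffel ::
    "('e::euclidean_space \<Rightarrow> 'e \<Rightarrow> 'e \<Rightarrow> real) \<Rightarrow> 'e \<Rightarrow> 'e \<Rightarrow> 'e \<Rightarrow> 'e" where
  "christoffel G x = (THE B. bilinear B \<and> (\<forall>u v. B u v = B v u) \<and>
     (\<forall>u v w. frechet_derivative (\<lambda>y. G y v w) (at x) u = G x (B u v) w + G x v (B u w)))"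

definition nabla ::
    "('e::euclidean_space \<Rightarrow> 'e \<Rightarrow> 'e \<Rightarrow> real) \<Rightarrow> ('e \<Rightarrow> 'e) \<Rightarrow> ('e \<Rightarrow> 'e) \<Rightarrow> 'e \<Rightarrow> 'e" where
  "nabla G X Y x = frechet_derivative Y (at x) (X x) + christoffel G x (X x) (Y x)"

definition nabla2 ::
    "('e::euclidean_space \<Rightarrow> 'e \<Rightarrow> 'e \<Rightarrow> real) \<Rightarrow> ('e \<Rightarrow> 'e) \<Rightarrow> ('e \<Rightarrow> 'e) \<Rightarrow> ('e \<Rightarrow> 'e) \<Rightarrow> 'e \<Rightarrow> 'e" where
  "nabla2 G X Y Z x = nabla G X (nabla G Y Z) x - nabla G (nabla G X Y) Z x"

definition nabla_form ::
    "('e::euclidean_space \<Rightarrow> 'e \<Rightarrow> 'e \<Rightarrow> real) \<Rightarrow> ('e \<Rightarrow> 'e \<Rightarrow> 'e \<Rightarrow> real) \<Rightarrow>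
     ('e \<Rightarrow> 'e) \<Rightarrow> ('e \<Rightarrow> 'e) \<Rightarrow> ('e \<Rightarrow> 'e) \<Rightarrow> 'e \<Rightarrow> real" where
  "nabla_form G \<omega> X Y Z x =
     frechet_derivative (\<lambda>y. \<omega> y (Y y) (Z y)) (at x) (X x)
     - \<omega> x (nabla G X Y x) (Z x) - \<omega> x (Y x) (nabla G X Z x)"


section \<open>Sums over orthonormal frames\<close>

definition orthonormal_basis :: "('e::euclidean_space \<Rightarrow> 'e \<Rightarrow> real) \<Rightarrow> 'e set \<Rightarrow> bool" where
  "orthonormal_basis b B \<longleftrightarrow>
     span B = UNIV \<and> (\<forall>u\<in>B. \<forall>v\<in>B. b u v = (if u = v then 1 else 0))"

definition metric_trace ::
    "('e::euclidean_space \<Rightarrow> 'e \<Rightarrow> real) \<Rightarrow> ('e \<Rightarrow> 'e \<Rightarrow> 'b::real_vector) \<Rightarrow> 'b" where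
  "metric_trace b T = (\<Sum>e\<in>(SOME B. orthonormal_basis b B). T e e)"

text \<open>
  The expressions summed over a local orthonormal frame below are tensorial in the frame fields.
  They are therefore evaluated on the extensions with constant components of the vectors of an
  orthonormal basis of the tangent space at \<open>x\<close>. By \<open>metric_trace_eq\<close> the choice of the basis is
  immaterial; for the two sums that differentiate twice, the theorems \<open>rough_laplacian_frame\<close> and
  \<open>T_phi_frame\<close> at the end recover the sums over arbitrary local orthonormal frames.
\<close>

definition rough_laplacian ::
    "('e::euclidean_space \<Rightarrow> 'e \<Rightarrow> 'e \<Rightarrow> real) \<Rightarrow> ('e \<Rightarrow> 'e) \<Rightarrow> 'e \<Rightarrow> 'e" where
  "rough_laplacian G Z x = - metric_trace (G x) (\<lambda>u v. nabla2 G (\<lambda>_. u) (\<lambda>_. v) Z x)"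

definition nabla_norm_sq ::
    "('e::euclidean_space \<Rightarrow> 'e \<Rightarrow> 'e \<Rightarrow> real) \<Rightarrow> ('e \<Rightarrow> 'e) \<Rightarrow> 'e \<Rightarrow> real" where
  "nabla_norm_sq G Z x =
     metric_trace (G x) (\<lambda>u v. G x (nabla G (\<lambda>_. u) Z x) (nabla G (\<lambda>_. v) Z x))"

definition tau ::
    "('e::euclidean_space \<Rightarrow> 'e \<Rightarrow> 'e \<Rightarrow> real) \<Rightarrow> ('e \<Rightarrow> 'e) \<Rightarrow> 'e \<Rightarrow> 'e" where
  "tau G \<xi> x = rough_laplacian G \<xi> x - nabla_norm_sq G \<xi> x *\<^sub>R \<xi> x"

text \<open>The orthogonal projection to \<open>\<D> = ker \<eta>\<close>, where \<open>\<eta> = g(\<xi>, \<cdot>)\<close> and \<open>\<xi>\<close> is a unit field.\<close>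
definition proj_D ::
    "('e::euclidean_space \<Rightarrow> 'e \<Rightarrow> 'e \<Rightarrow> real) \<Rightarrow> ('e \<Rightarrow> 'e) \<Rightarrow> 'e \<Rightarrow> 'e \<Rightarrow> 'e" where
  "proj_D G \<xi> x v = v - G x (\<xi> x) v *\<^sub>R \<xi> x"

text \<open>\<open>(\<nabla>bar\<^sub>X J) Y = \<nabla>bar\<^sub>X (J Y) - J (\<nabla>bar\<^sub>X Y)\<close> for \<open>Y\<close> a section of \<open>\<D>\<close>, where \<open>J\<close> is the
  restriction of \<open>\<phi>\<close> to \<open>\<D>\<close>.\<close>
definition nabla_bar_J ::
    "('e::euclidean_space \<Rightarrow> 'e \<Rightarrow> 'e \<Rightarrow> real) \<Rightarrow> ('e \<Rightarrow> 'e) \<Rightarrow> ('e \<Rightarrow> 'e \<Rightarrow> 'e) \<Rightarrow>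
     ('e \<Rightarrow> 'e) \<Rightarrow> ('e \<Rightarrow> 'e) \<Rightarrow> 'e \<Rightarrow> 'e" where
  "nabla_bar_J G \<xi> \<phi> X Y x =
     proj_D G \<xi> x (nabla G X (\<lambda>y. \<phi> y (Y y)) x) - \<phi> x (proj_D G \<xi> x (nabla G X Y x))"

definition T_phi ::
    "('e::euclidean_space \<Rightarrow> 'e \<Rightarrow> 'e \<Rightarrow> real) \<Rightarrow> ('e \<Rightarrow> 'e) \<Rightarrow> ('e \<Rightarrow> 'e \<Rightarrow> 'e) \<Rightarrow> 'e \<Rightarrow> 'e" where
  "T_phi G \<xi> \<phi> x =
     metric_trace (G x) (\<lambda>u v. nabla_bar_J G \<xi> \<phi> (\<lambda>_. u) (nabla G (\<lambda>_. v) \<xi>) x)"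

text \<open>The codifferential of a 2-form, \<open>(\<delta>\<omega>)(w) = - \<Sum>\<^sub>i (\<nabla>\<omega>)(F\<^sub>i; F\<^sub>i, w)\<close>.\<close>
definition codifferential ::
    "('e::euclidean_space \<Rightarrow> 'e \<Rightarrow> 'e \<Rightarrow> real) \<Rightarrow> ('e \<Rightarrow> 'e \<Rightarrow> 'e \<Rightarrow> real) \<Rightarrow> 'e \<Rightarrow> 'e \<Rightarrow> real" where
  "codifferential G \<omega> x w =
     - metric_trace (G x) (\<lambda>u v. nabla_form G \<omega> (\<lambda>_. u) (\<lambda>_. v) (\<lambda>_. w) x)"


section \<open>Harmonicity, cosymplectic manifolds and warped products\<close>

definition harmonic_unit_field ::
    "'i set \<Rightarrow> ('i \<Rightarrow> 'a set) \<Rightarrow> ('i \<Rightarrow> 'a \<Rightarrow> 'e::euclidean_space) \<Rightarrow>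
     ('i \<Rightarrow> 'e \<Rightarrow> 'e \<Rightarrow> 'e \<Rightarrow> real) \<Rightarrow> ('i \<Rightarrow> 'e \<Rightarrow> 'e) \<Rightarrow> bool" where
  "harmonic_unit_field I U \<kappa> g \<xi> \<longleftrightarrow> (\<forall>i\<in>I. \<forall>x\<in>\<kappa> i ` U i. tau (g i) (\<xi> i) x = 0)"

definition first_harmonic_section_eq ::
    "'i set \<Rightarrow> ('i \<Rightarrow> 'a set) \<Rightarrow> ('i \<Rightarrow> 'a \<Rightarrow> 'e::euclidean_space) \<Rightarrow>
     ('i \<Rightarrow> 'e \<Rightarrow> 'e \<Rightarrow> 'e \<Rightarrow> real) \<Rightarrow> ('i \<Rightarrow> 'e \<Rightarrow> 'e) \<Rightarrow> ('i \<Rightarrow> 'e \<Rightarrow> 'e \<Rightarrow> 'e) \<Rightarrow> bool" where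
  "first_harmonic_section_eq I U \<kappa> g \<xi> \<phi> \<longleftrightarrow>
     (\<forall>i\<in>I. \<forall>x\<in>\<kappa> i ` U i.
        tau (g i) (\<xi> i) x + (1/2) *\<^sub>R \<phi> i x (T_phi (g i) (\<xi> i) (\<phi> i) x) = 0)"

definition kaehler_form ::
    "('i \<Rightarrow> 'e \<Rightarrow> 'e \<Rightarrow> 'e \<Rightarrow> real) \<Rightarrow> ('i \<Rightarrow> 'e \<Rightarrow> 'e \<Rightarrow> 'e) \<Rightarrow> 'i \<Rightarrow> 'e \<Rightarrow> 'e \<Rightarrow> 'e \<Rightarrow> real" where
  "kaehler_form g J i x u v = g i x u (J i x v)"

definition cosymplectic ::
    "'i set \<Rightarrow> ('i \<Rightarrow> 'a set) \<Rightarrow> ('i \<Rightarrow> 'a \<Rightarrow> 'e::euclidean_space) \<Rightarrow>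
     ('i \<Rightarrow> 'e \<Rightarrow> 'e \<Rightarrow> 'e \<Rightarrow> real) \<Rightarrow> ('i \<Rightarrow> 'e \<Rightarrow> 'e \<Rightarrow> 'e) \<Rightarrow> bool" where
  "cosymplectic I U \<kappa> g J \<longleftrightarrow>
     (\<forall>i\<in>I. \<forall>x\<in>\<kappa> i ` U i. \<forall>w. codifferential (g i) (kaehler_form g J i) x w = 0)"

text \<open>The manifold \<open>\<real> \<times> M\<close> has the charts \<open>id \<times> \<kappa> i\<close> on \<open>\<real> \<times> U i\<close>, indexed like those of \<open>M\<close>.\<close>

definition line_times_dom :: "('i \<Rightarrow> 'a set) \<Rightarrow> 'i \<Rightarrow> (real \<times> 'a) set" where
  "line_times_dom U i = UNIV \<times> U i"

definition line_times_chart :: "('i \<Rightarrow> 'a \<Rightarrow> 'e) \<Rightarrow> 'i \<Rightarrow> real \<times> 'a \<Rightarrow> real \<times> 'e" where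
  "line_times_chart \<kappa> i = map_prod id (\<kappa> i)"

definition warped_metric ::
    "(real \<Rightarrow> real) \<Rightarrow> ('i \<Rightarrow> 'e \<Rightarrow> 'e \<Rightarrow> 'e \<Rightarrow> real) \<Rightarrow>
     'i \<Rightarrow> real \<times> 'e \<Rightarrow> real \<times> 'e \<Rightarrow> real \<times> 'e \<Rightarrow> real" where
  "warped_metric f g i = (\<lambda>(t, x) (a, u) (b, v). a * b + (f t)\<^sup>2 * g i x u v)"

definition warped_reeb :: "'i \<Rightarrow> real \<times> 'e::zero \<Rightarrow> real \<times> 'e" where
  "warped_reeb i = (\<lambda>_. (1, 0))"

definition warped_phi ::
    "('i \<Rightarrow> 'e \<Rightarrow> 'e \<Rightarrow> 'e) \<Rightarrow> 'i \<Rightarrow> real \<times> 'e \<Rightarrow> real \<times> 'e \<Rightarrow> real \<times> 'e" where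
  "warped_phi J i = (\<lambda>(t, x) (a, u). (0, J i x u))"


section \<open>Consistency of the definitions\<close>

subsection \<open>Orthonormal bases and traces\<close>

lemma inner_form_Riesz:
  fixes b :: "'e::euclidean_space \<Rightarrow> 'e \<Rightarrow> real"
  assumes b: "inner_form b" and l: "linear l"
  shows "\<exists>!w. \<forall>z. b w z = l z"
proof -
  have bl: "bilinear b" and pos: "\<And>u. u \<noteq> 0 \<Longrightarrow> b u u > 0"
    using b by (auto simp: inner_form_def)
  define A where "A w = (\<Sum>k\<in>Basis. b w k *\<^sub>R k)" for w
  have lin: "linear A"
    unfolding A_def using bl
    by (intro linear_compose_sum ballI)
       (auto intro!: linearI simp: bilinear_ladd bilinear_lmul scaleR_left_distrib)
  have A: "A w = (\<Sum>k\<in>Basis. l k *\<^sub>R k) \<longleftrightarrow> (\<forall>z. b w z = l z)"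
    if l: "linear l" for w and l :: "'e \<Rightarrow> real"
  proof
    assume "A w = (\<Sum>k\<in>Basis. l k *\<^sub>R k)"
    then have eq: "b w k = l k" if "k \<in> Basis" for k
      using that by (simp add: A_def euclidean_eq_iff[where 'a='e])
    show "\<forall>z. b w z = l z"
      using linear_eq_on[OF _ l, of "b w" _ Basis] bl eq
      by (auto simp: bilinear_def span_Basis)
  qed (simp add: A_def)
  have inj: "inj A"
    unfolding linear_injective_0[OF lin]
  proof (intro allI impI)
    fix w assume "A w = 0"
    then have "\<forall>z. b w z = 0"
      using A[of "\<lambda>_. 0" w] by (simp add: linear_0 linear_zero)
    then show "w = 0" using pos[of w] by force
  qed
  with lin have surj: "surj A" by (rule eucl.linear_inj_imp_surj)
  have "\<exists>!w. A w = (\<Sum>k\<in>Basis. l k *\<^sub>R k)"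
  proof (rule ex_ex1I)
    show "\<exists>w. A w = (\<Sum>k\<in>Basis. l k *\<^sub>R k)" using surj by (metis surj_def)
  qed (rule injD[OF inj], simp)
  then show ?thesis using A[OF l] by simp
qed

lemma orthonormal_coeff:
  assumes b: "bilinear b" and B: "\<And>u v. u \<in> B \<Longrightarrow> v \<in> B \<Longrightarrow> b u v = (if u = v then 1 else (0::real))"
    and fin: "finite B" and v: "v \<in> B"
  shows "b (\<Sum>e\<in>B. c e *\<^sub>R e) v = c v"
proof -
  have lin: "linear (\<lambda>z. b z v)" using b by (simp add: bilinear_def)
  have "b (\<Sum>e\<in>B. c e *\<^sub>R e) v = (\<Sum>e\<in>B. c e * b e v)"
    by (simp add: linear_sum[OF lin] linear_scale[OF lin])
  also have "\<dots> = (\<Sum>e\<in>B. if e = v then c e else 0)"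
    using B v by (intro sum.cong) auto
  finally show ?thesis using fin v by simp
qed

lemma orthonormal_independent:
  assumes b: "bilinear b" and B: "\<And>u v. u \<in> B \<Longrightarrow> v \<in> B \<Longrightarrow> b u v = (if u = v then 1 else (0::real))"
  shows "independent B"
  unfolding independent_explicit_finite_subsets
proof (intro allI impI ballI)
  fix A u v assume A: "A \<subseteq> B" "finite A" "(\<Sum>e\<in>A. u e *\<^sub>R e) = 0" "v \<in> A"
  have "b (\<Sum>e\<in>A. u e *\<^sub>R e) v = u v"
  proof (rule orthonormal_coeff[OF b _ A(2) A(4)])
    show "b e e' = (if e = e' then 1 else 0)" if "e \<in> A" "e' \<in> A" for e e'
      using B A(1) that by blast
  qed
  then show "u v = 0" unfolding A(3) bilinear_lzero[OF b] by simp
qed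

lemma orthonormal_basis_finite:
  assumes b: "inner_form b" and B: "orthonormal_basis b B"
  shows "finite B"
proof -
  have "independent B"
  proof (rule orthonormal_independent)
    show "bilinear b" using b by (simp add: inner_form_def)
  qed (use B in \<open>simp add: orthonormal_basis_def\<close>)
  then show ?thesis using independent_bound by blast
qed

lemma orthonormal_basis_exists:
  fixes b :: "'e::euclidean_space \<Rightarrow> 'e \<Rightarrow> real"
  assumes "inner_form b"
  shows "\<exists>B. orthonormal_basis b B"
proof -
  have bl: "bilinear b" and sym: "\<And>u v. b u v = b v u" and pos: "\<And>u. u \<noteq> 0 \<Longrightarrow> b u u > 0"
    using assms by (auto simp: inner_form_def)
  have "\<exists>B. finite B \<and> card B = k \<and> (\<forall>u\<in>B. \<forall>v\<in>B. b u v = (if u = v then 1 else 0))"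
    if "k \<le> DIM('e)" for k
    using that
  proof (induction k)
    case (Suc k)
    then obtain B where B: "finite B" "card B = k"
      and on: "\<And>u v. u \<in> B \<Longrightarrow> v \<in> B \<Longrightarrow> b u v = (if u = v then 1 else 0)"
      by auto
    have "dim B \<le> k" using B dim_le_card' by blast
    then have "span B \<noteq> UNIV" using Suc.prems by (metis dim_UNIV dim_span not_less_eq_eq)
    then obtain v where v: "v \<notin> span B" by blast
    define w where "w = v - (\<Sum>e\<in>B. b v e *\<^sub>R e)"
    have "(\<Sum>e\<in>B. b v e *\<^sub>R e) \<in> span B" by (intro span_sum span_scale span_base)
    then have "w \<noteq> 0" using v by (auto simp: w_def)
    then have w: "b w w > 0" by (rule pos)
    have orth: "b w e = 0" if "e \<in> B" for e
      using orthonormal_coeff[OF bl on B(1) that] by (simp add: w_def bilinear_lsub[OF bl])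
    define z where "z = (1 / sqrt (b w w)) *\<^sub>R w"
    have zz: "b z z = 1"
      using w by (simp add: z_def bilinear_lmul[OF bl] bilinear_rmul[OF bl] divide_simps)
    have ze: "b z e = 0" "b e z = 0" if "e \<in> B" for e
      using orth[OF that] sym by (simp_all add: z_def bilinear_lmul[OF bl] bilinear_rmul[OF bl])
    have "z \<notin> B" using zz ze by auto
    then show ?case
      using B on zz ze by (intro exI[of _ "insert z B"]) auto
  next
    case 0
    show ?case by (rule exI[of _ "{}"]) simp
  qed
  from this[OF order_refl] obtain B where B: "finite B" "card B = DIM('e)"
    and on: "\<And>u v. u \<in> B \<Longrightarrow> v \<in> B \<Longrightarrow> b u v = (if u = v then 1 else 0)"
    by blast
  have "independent B" by (rule orthonormal_independent[OF bl on])
  then have "span B = UNIV" using B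
    by (metis card_eq_dim dim_UNIV subset_UNIV top.extremum_uniqueI)
  then show ?thesis using on by (auto simp: orthonormal_basis_def)
qed

lemma orthonormal_expansion:
  assumes b: "inner_form b" and B: "orthonormal_basis b B"
  shows "u = (\<Sum>e\<in>B. b u e *\<^sub>R e)"
proof -
  have fin: "finite B" using assms by (rule orthonormal_basis_finite)
  have bl: "bilinear b" using b by (simp add: inner_form_def)
  have "u \<in> range (\<lambda>c. \<Sum>e\<in>B. c e *\<^sub>R e)"
    using B unfolding orthonormal_basis_def span_finite[OF fin] by blast
  then obtain c where c: "u = (\<Sum>e\<in>B. c e *\<^sub>R e)" by blast
  have "b u e = c e" if "e \<in> B" for e
    unfolding c using B by (intro orthonormal_coeff[OF bl _ fin that]) (auto simp: orthonormal_basis_def)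
  then show ?thesis using c by simp
qed

lemma bilinear_expand:
  assumes T: "bilinear T"
  shows "T (\<Sum>c\<in>C. p c *\<^sub>R c) (\<Sum>d\<in>D. q d *\<^sub>R d) = (\<Sum>c\<in>C. \<Sum>d\<in>D. (p c * q d) *\<^sub>R T c d)"
proof -
  have l: "linear (\<lambda>u. T u v)" and r: "linear (T u)" for u v
    using T by (auto simp: bilinear_def)
  have "T (\<Sum>c\<in>C. p c *\<^sub>R c) (\<Sum>d\<in>D. q d *\<^sub>R d) = (\<Sum>c\<in>C. p c *\<^sub>R T c (\<Sum>d\<in>D. q d *\<^sub>R d))"
    by (simp only: linear_sum[OF l] linear_scale[OF l])
  also have "\<dots> = (\<Sum>c\<in>C. p c *\<^sub>R (\<Sum>d\<in>D. q d *\<^sub>R T c d))"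
    by (simp only: linear_sum[OF r] linear_scale[OF r])
  finally show ?thesis by (simp only: scaleR_sum_right scaleR_scaleR)
qed

lemma trace_basis_independent:
  assumes b: "inner_form b" and B: "orthonormal_basis b B" and C: "orthonormal_basis b C"
    and T: "bilinear T"
  shows "(\<Sum>e\<in>B. T e e) = (\<Sum>c\<in>C. T c c)"
proof -
  have fin: "finite B" "finite C" using assms by (auto intro: orthonormal_basis_finite)
  have bl: "bilinear b" and sym: "\<And>u v. b u v = b v u" using b by (auto simp: inner_form_def)
  have bb: "(\<Sum>e\<in>B. b c e * b d e) = b c d" for c d
  proof -
    have lin: "linear (b c)" using bl by (simp add: bilinear_def)
    have "b c d = b c (\<Sum>e\<in>B. b d e *\<^sub>R e)" by (simp only: orthonormal_expansion[OF b B, symmetric])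
    also have "\<dots> = (\<Sum>e\<in>B. b c e * b d e)"
      by (simp add: linear_sum[OF lin] linear_scale[OF lin] mult.commute)
    finally show ?thesis by simp
  qed
  have "(\<Sum>e\<in>B. T e e) = (\<Sum>e\<in>B. \<Sum>c\<in>C. \<Sum>d\<in>C. (b c e * b d e) *\<^sub>R T c d)"
  proof (rule sum.cong[OF refl])
    fix e
    have "T e e = T (\<Sum>c\<in>C. b e c *\<^sub>R c) (\<Sum>d\<in>C. b e d *\<^sub>R d)"
      by (simp only: orthonormal_expansion[OF b C, symmetric])
    also have "\<dots> = (\<Sum>c\<in>C. \<Sum>d\<in>C. (b e c * b e d) *\<^sub>R T c d)"
      by (rule bilinear_expand[OF T])
    finally show "T e e = (\<Sum>c\<in>C. \<Sum>d\<in>C. (b c e * b d e) *\<^sub>R T c d)"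
      by (simp only: sym[of e])
  qed
  also have "\<dots> = (\<Sum>c\<in>C. \<Sum>e\<in>B. \<Sum>d\<in>C. (b c e * b d e) *\<^sub>R T c d)" by (rule sum.swap)
  also have "\<dots> = (\<Sum>c\<in>C. \<Sum>d\<in>C. (\<Sum>e\<in>B. b c e * b d e) *\<^sub>R T c d)"
    unfolding scaleR_left.sum by (intro sum.cong refl sum.swap)
  also have "\<dots> = (\<Sum>c\<in>C. \<Sum>d\<in>C. if d = c then T c d else 0)"
    unfolding bb using C by (intro sum.cong refl) (auto simp: orthonormal_basis_def)
  also have "\<dots> = (\<Sum>c\<in>C. T c c)" using fin by simp
  finally show ?thesis .
qed

lemma metric_trace_eq:
  assumes "inner_form b" and "orthonormal_basis b B" and "bilinear T"
  shows "metric_trace b T = (\<Sum>e\<in>B. T e e)"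
proof -
  have "orthonormal_basis b (SOME B. orthonormal_basis b B)"
    unfolding some_eq_ex using orthonormal_basis_exists[OF assms(1)] .
  then show ?thesis
    unfolding metric_trace_def by (rule trace_basis_independent[OF assms(1) _ assms(2,3)])
qed


subsection \<open>The Levi-Civita connection\<close>

definition metric_near :: "'e set \<Rightarrow> ('e::euclidean_space \<Rightarrow> 'e \<Rightarrow> 'e \<Rightarrow> real) \<Rightarrow> bool" where
  "metric_near S G \<longleftrightarrow> open S \<and> (\<forall>y\<in>S. inner_form (G y)) \<and>
     (\<forall>u v. \<forall>y\<in>S. (\<lambda>z. G z u v) differentiable (at y))"

lemma riemannian_metric_near:
  assumes "smooth_manifold M I U \<kappa>" "riemannian_metric I U \<kappa> g" "i \<in> I"
  shows "metric_near (\<kappa> i ` U i) (g i)"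
  unfolding metric_near_def
proof (intro conjI allI ballI)
  show "open (\<kappa> i ` U i)" using assms(1,3) by (simp add: smooth_manifold_def)
next
  fix y assume "y \<in> \<kappa> i ` U i"
  moreover have "\<forall>i\<in>I. \<forall>x\<in>\<kappa> i ` U i. inner_form (g i x)"
    using assms(2) unfolding riemannian_metric_def by (elim conjE)
  ultimately show "inner_form (g i y)" using assms(3) by blast
next
  fix u v y assume y: "y \<in> \<kappa> i ` U i"
  have "\<forall>i\<in>I. \<forall>u v. smooth_on (\<kappa> i ` U i) (\<lambda>x. g i x u v)"
    using assms(2) unfolding riemannian_metric_def by (elim conjE)
  then have "smooth_on (\<kappa> i ` U i) (\<lambda>z. g i z u v)" using assms(3) by blast
  then have "higher_differentiable_on (\<kappa> i ` U i) (\<lambda>z. g i z u v) (Suc 0)"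
    unfolding smooth_on_def by (rule spec)
  then show "(\<lambda>z. g i z u v) differentiable (at y)"
    unfolding higher_differentiable_on.simps using y by (elim conjE bspec)
qed

lemma christoffel_ex1:
  assumes G: "metric_near S G" and x: "x \<in> S"
  shows "\<exists>!B. bilinear B \<and> (\<forall>u v. B u v = B v u) \<and>
     (\<forall>u v w. frechet_derivative (\<lambda>y. G y v w) (at x) u = G x (B u v) w + G x v (B u w))"
proof -
  have S: "open S" and inn: "\<And>y. y \<in> S \<Longrightarrow> inner_form (G y)"
    and diff: "\<And>u v. (\<lambda>z. G z u v) differentiable (at x)"
    using G x by (auto simp: metric_near_def)
  have bl: "bilinear (G y)" and sym: "G y u v = G y v u" if "y \<in> S" for y u v
    using inn[OF that] by (auto simp: inner_form_def)
  define D where "D u v w = frechet_derivative (\<lambda>y. G y v w) (at x) u" for u v w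
  have hd: "((\<lambda>y. G y v w) has_derivative (\<lambda>u. D u v w)) (at x)" for v w
    using diff[of v w] unfolding D_def frechet_derivative_works .
  have D1: "linear (\<lambda>u. D u v w)" for v w
    using hd[of v w] by (simp add: has_derivative_linear)
  have uniq: "D u v w = d u"
    if "((\<lambda>y. h y) has_derivative d) (at x)" "\<And>y. y \<in> S \<Longrightarrow> h y = G y v w" for h d u v w
  proof -
    have "((\<lambda>y. G y v w) has_derivative d) (at x)"
      using has_derivative_transform_within_open[OF that(1) S x that(2)] .
    then show ?thesis using has_derivative_unique[OF hd] by metis
  qed
  have Dsym: "D u v w = D u w v" for u v w
    by (rule uniq[OF hd]) (rule sym)
  have D3: "linear (\<lambda>w. D u v w)" for u v
  proof (rule linearI)
    show "D u v (w + w') = D u v w + D u v w'" for w w'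
      by (rule uniq[OF has_derivative_add[OF hd hd]]) (simp add: bilinear_radd[OF bl])
    show "D u v (c *\<^sub>R w) = c *\<^sub>R D u v w" for c w
      by (rule uniq[OF has_derivative_scaleR_right[OF hd]]) (simp add: bilinear_rmul[OF bl])
  qed
  have D2: "linear (\<lambda>v. D u v w)" for u w
    using D3[of u w] by (subst Dsym)
  note Dadd = linear_add[OF D1] linear_add[OF D2] linear_add[OF D3]
  note Dscale = linear_scale[OF D1] linear_scale[OF D2] linear_scale[OF D3]
  define K where "K u v w = (D u v w + D v u w - D w u v) / 2" for u v w
  have Klin: "linear (\<lambda>w. K u v w)" for u v
    by (rule linearI) (auto simp: K_def Dadd Dscale field_simps)
  define B where "B u v = (THE w. \<forall>z. G x w z = K u v z)" for u v
  have B: "G x (B u v) z = K u v z" for u v z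
    using theI'[OF inner_form_Riesz[OF inn[OF x] Klin[of u v]]] by (simp add: B_def)
  have eqI: "w = w'" if "\<And>z. G x w z = G x w' z" for w w'
    using inner_form_Riesz[OF inn[OF x], of "G x w'"] that bl[OF x]
    by (auto simp: bilinear_def)
  have Gx: "G x u v = G x v u" for u v using sym[OF x] .
  note Glin = bilinear_ladd[OF bl[OF x]] bilinear_lmul[OF bl[OF x]]
  have p1: "bilinear B"
    unfolding bilinear_def
    by (intro conjI allI linearI eqI; simp add: Glin B K_def Dadd Dscale field_simps)
  have p2: "B u v = B v u" for u v
    by (rule eqI) (simp add: B K_def Dsym[of _ u v])
  have p3: "D u v w = G x (B u v) w + G x v (B u w)" for u v w
    using Dsym[of u v w] Dsym[of w u v] Dsym[of v u w] by (simp add: Gx[of v] B K_def field_simps)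
  have p4: "B' = B"
    if B': "bilinear B'" "\<And>u v. B' u v = B' v u"
      "\<And>u v w. D u v w = G x (B' u v) w + G x v (B' u w)" for B'
  proof (intro ext eqI)
    fix u v z
    show "G x (B' u v) z = G x (B u v) z"
      unfolding B K_def B'(3)
      using B'(2)[of v u] B'(2)[of z u] B'(2)[of z v] Gx[of v "B' u z"] Gx[of u "B' v z"] by simp
  qed
  show ?thesis
    unfolding D_def[symmetric]
  proof (rule ex1I)
    show "bilinear B \<and> (\<forall>u v. B u v = B v u) \<and>
        (\<forall>u v w. D u v w = G x (B u v) w + G x v (B u w))"
      using p1 p2 p3 by (intro conjI allI)
    show "B' = B" if "bilinear B' \<and> (\<forall>u v. B' u v = B' v u) \<and>
        (\<forall>u v w. D u v w = G x (B' u v) w + G x v (B' u w))" for B'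
      using that by (intro p4) (elim conjE allE, assumption)+
  qed
qed

lemma
  assumes "metric_near S G" and "x \<in> S"
  shows bilinear_christoffel: "bilinear (christoffel G x)"
    and christoffel_sym: "christoffel G x u v = christoffel G x v u"
    and christoffel_metric: "frechet_derivative (\<lambda>y. G y v w) (at x) u
           = G x (christoffel G x u v) w + G x v (christoffel G x u w)"
  using theI'[OF christoffel_ex1[OF assms]] unfolding christoffel_def by blast+

text \<open>Absence of torsion; the right-hand side is the bracket \<open>[X, Y]\<close>.\<close>
lemma nabla_torsion_free:
  assumes "metric_near S G" and "x \<in> S"
  shows "nabla G X Y x - nabla G Y X x =
    frechet_derivative Y (at x) (X x) - frechet_derivative X (at x) (Y x)"
  using christoffel_sym[OF assms, of "X x" "Y x"] by (simp add: nabla_def)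

lemma nabla_metric:
  assumes G: "metric_near S G" and x: "x \<in> S"
    and Y: "Y differentiable (at x)" and Z: "Z differentiable (at x)"
  shows "frechet_derivative (\<lambda>y. G y (Y y) (Z y)) (at x) (X x) =
    G x (nabla G X Y x) (Z x) + G x (Y x) (nabla G X Z x)"
proof -
  have S: "open S" and bl: "\<And>y. y \<in> S \<Longrightarrow> bilinear (G y)"
    and diff: "\<And>u v. (\<lambda>z. G z u v) differentiable (at x)"
    using G x by (auto simp: metric_near_def inner_form_def)
  have hY: "(Y has_derivative frechet_derivative Y (at x)) (at x)"
    and hZ: "(Z has_derivative frechet_derivative Z (at x)) (at x)"
    and hG: "((\<lambda>z. G z u v) has_derivative frechet_derivative (\<lambda>z. G z u v) (at x)) (at x)" for u v
    using Y Z diff by (simp_all add: frechet_derivative_works[symmetric])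
  have exp: "b u v = (\<Sum>k\<in>Basis. \<Sum>l\<in>Basis. (u \<bullet> k) * (v \<bullet> l) * b k l)"
    if b: "bilinear b" for b :: "'a \<Rightarrow> 'a \<Rightarrow> real" and u v
  proof -
    have "b u v = b (\<Sum>k\<in>Basis. (u \<bullet> k) *\<^sub>R k) (\<Sum>l\<in>Basis. (v \<bullet> l) *\<^sub>R l)"
      by (simp add: euclidean_representation)
    also have "\<dots> = (\<Sum>k\<in>Basis. \<Sum>l\<in>Basis. (u \<bullet> k) * (v \<bullet> l) * b k l)"
      by (simp only: bilinear_expand[OF b] real_scaleR_def)
    finally show ?thesis .
  qed
  define D where "D h = (\<Sum>k\<in>Basis. \<Sum>l\<in>Basis.
      (Y x \<bullet> k) * (Z x \<bullet> l) * frechet_derivative (\<lambda>z. G z k l) (at x) h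
      + ((Y x \<bullet> k) * (frechet_derivative Z (at x) h \<bullet> l)
         + (frechet_derivative Y (at x) h \<bullet> k) * (Z x \<bullet> l)) * G x k l)" for h
  have "((\<lambda>y. \<Sum>k\<in>Basis. \<Sum>l\<in>Basis. (Y y \<bullet> k) * (Z y \<bullet> l) * G y k l) has_derivative D) (at x)"
    unfolding D_def
    by (rule has_derivative_sum, rule has_derivative_sum,
        rule has_derivative_mult[OF has_derivative_mult[OF has_derivative_inner_left[OF hY]
          has_derivative_inner_left[OF hZ]] hG])
  then have "((\<lambda>y. G y (Y y) (Z y)) has_derivative D) (at x)"
    by (rule has_derivative_transform_within_open[OF _ S x]) (rule exp[OF bl, symmetric])
  then have "frechet_derivative (\<lambda>y. G y (Y y) (Z y)) (at x) = D"
    by (rule frechet_derivative_at[symmetric])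
  moreover have "D h = G x (Y x) (frechet_derivative Z (at x) h)
      + G x (frechet_derivative Y (at x) h) (Z x)
      + (G x (christoffel G x h (Y x)) (Z x) + G x (Y x) (christoffel G x h (Z x)))" for h
  proof -
    let ?c = "christoffel G x h"
    have lc: "linear ?c" using bilinear_christoffel[OF G x] by (simp add: bilinear_def)
    have "bilinear (\<lambda>v w. G x (?c v) w + G x v (?c w))"
      unfolding bilinear_def
      by (intro conjI allI linearI)
         (simp_all add: bilinear_ladd[OF bl[OF x]] bilinear_radd[OF bl[OF x]]
           bilinear_lmul[OF bl[OF x]] bilinear_rmul[OF bl[OF x]]
           linear_add[OF lc] linear_scale[OF lc] distrib_left)
    from exp[OF this, of "Y x" "Z x"]
    have "G x (?c (Y x)) (Z x) + G x (Y x) (?c (Z x)) =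
      (\<Sum>k\<in>Basis. \<Sum>l\<in>Basis. (Y x \<bullet> k) * (Z x \<bullet> l) * frechet_derivative (\<lambda>z. G z k l) (at x) h)"
      by (simp only: christoffel_metric[OF G x])
    moreover have "D h =
      (\<Sum>k\<in>Basis. \<Sum>l\<in>Basis. (Y x \<bullet> k) * (Z x \<bullet> l) * frechet_derivative (\<lambda>z. G z k l) (at x) h)
      + ((\<Sum>k\<in>Basis. \<Sum>l\<in>Basis. (Y x \<bullet> k) * (frechet_derivative Z (at x) h \<bullet> l) * G x k l)
      + (\<Sum>k\<in>Basis. \<Sum>l\<in>Basis. (frechet_derivative Y (at x) h \<bullet> k) * (Z x \<bullet> l) * G x k l))"
      unfolding D_def by (simp only: sum.distrib distrib_right)
    ultimately show ?thesis
      by (simp add: exp[OF bl[OF x], of "Y x"] exp[OF bl[OF x], of _ "Z x"])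
  qed
  ultimately show ?thesis
    by (simp add: nabla_def bilinear_ladd[OF bl[OF x]] bilinear_radd[OF bl[OF x]])
qed


subsection \<open>Independence of the frame\<close>

lemma has_derivative_combination:
  fixes L :: "'e::euclidean_space \<Rightarrow> 'e \<Rightarrow> 'b::real_normed_vector"
  assumes S: "open S" "x \<in> S" and W: "\<And>y. y \<in> S \<Longrightarrow> W y = (\<Sum>b\<in>Basis. (Y y \<bullet> b) *\<^sub>R L b y)"
    and Y: "Y differentiable (at x)" and L: "\<And>b. L b differentiable (at x)"
  shows "frechet_derivative W (at x) u = (\<Sum>b\<in>Basis. (frechet_derivative Y (at x) u \<bullet> b) *\<^sub>R L b x)
    + (\<Sum>b\<in>Basis. (Y x \<bullet> b) *\<^sub>R frechet_derivative (L b) (at x) u)"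
proof -
  have hY: "(Y has_derivative frechet_derivative Y (at x)) (at x)"
    and hL: "(L b has_derivative frechet_derivative (L b) (at x)) (at x)" for b
    using Y L by (simp_all add: frechet_derivative_works[symmetric])
  have "((\<lambda>y. \<Sum>b\<in>Basis. (Y y \<bullet> b) *\<^sub>R L b y) has_derivative
      (\<lambda>u. \<Sum>b\<in>Basis. (Y x \<bullet> b) *\<^sub>R frechet_derivative (L b) (at x) u
        + (frechet_derivative Y (at x) u \<bullet> b) *\<^sub>R L b x)) (at x)"
    by (rule has_derivative_sum,
        rule has_derivative_scaleR[OF has_derivative_inner_left[OF hY] hL])
  then have "(W has_derivative
      (\<lambda>u. \<Sum>b\<in>Basis. (Y x \<bullet> b) *\<^sub>R frechet_derivative (L b) (at x) u
        + (frechet_derivative Y (at x) u \<bullet> b) *\<^sub>R L b x)) (at x)"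
    by (rule has_derivative_transform_within_open[OF _ S]) (simp add: W)
  note D = frechet_derivative_at[OF this, symmetric]
  show ?thesis unfolding D by (simp only: sum.distrib add.commute)
qed

lemma linear_nabla:
  assumes G: "metric_near S G" and y: "y \<in> S" and Z: "Z differentiable (at y)"
  shows "linear (\<lambda>v. nabla G (\<lambda>_. v) Z y)"
proof -
  have "linear (\<lambda>v. christoffel G y v (Z y))"
    using bilinear_christoffel[OF G y] by (simp add: bilinear_def)
  then show ?thesis
    unfolding nabla_def by (intro linear_compose_add linear_frechet_derivative Z)
qed

lemma nabla_components:
  assumes G: "metric_near S G" and y: "y \<in> S" and Z: "Z differentiable (at y)"
  shows "nabla G Y Z y = (\<Sum>b\<in>Basis. (Y y \<bullet> b) *\<^sub>R nabla G (\<lambda>_. b) Z y)"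
proof -
  note l = linear_nabla[OF G y Z]
  have "nabla G Y Z y = nabla G (\<lambda>_. \<Sum>b\<in>Basis. (Y y \<bullet> b) *\<^sub>R b) Z y"
    by (simp add: nabla_def euclidean_representation)
  also have "\<dots> = (\<Sum>b\<in>Basis. (Y y \<bullet> b) *\<^sub>R nabla G (\<lambda>_. b) Z y)"
    by (simp only: linear_sum[OF l] linear_scale[OF l])
  finally show ?thesis .
qed

lemma nabla2_pointwise:
  assumes G: "metric_near S G" and x: "x \<in> S"
    and Z: "\<forall>y\<in>S. Z differentiable (at y)"
    and Z2: "\<And>v. nabla G (\<lambda>_. v) Z differentiable (at x)"
    and Y: "Y differentiable (at x)"
  shows "nabla2 G X Y Z x =
    (\<Sum>b\<in>Basis. (Y x \<bullet> b) *\<^sub>R frechet_derivative (nabla G (\<lambda>_. b) Z) (at x) (X x))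
    + christoffel G x (X x) (nabla G (\<lambda>_. Y x) Z x)
    - nabla G (\<lambda>_. christoffel G x (X x) (Y x)) Z x"
proof -
  have S: "open S" using G by (simp add: metric_near_def)
  let ?DY = "frechet_derivative Y (at x) (X x)"
  have e: "nabla G Y Z y = (\<Sum>b\<in>Basis. (Y y \<bullet> b) *\<^sub>R nabla G (\<lambda>_. b) Z y)" if "y \<in> S" for y
    using nabla_components[OF G that bspec[OF Z that]] .
  have c: "nabla G (\<lambda>_. ?DY) Z x = (\<Sum>b\<in>Basis. (?DY \<bullet> b) *\<^sub>R nabla G (\<lambda>_. b) Z x)"
    using nabla_components[OF G x bspec[OF Z x], of "\<lambda>_. ?DY"] .
  have "frechet_derivative (nabla G Y Z) (at x) (X x) = nabla G (\<lambda>_. ?DY) Z x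
      + (\<Sum>b\<in>Basis. (Y x \<bullet> b) *\<^sub>R frechet_derivative (nabla G (\<lambda>_. b) Z) (at x) (X x))"
    unfolding c
    by (rule has_derivative_combination[OF S x, of "nabla G Y Z" Y "\<lambda>b. nabla G (\<lambda>_. b) Z", OF e Y Z2])
  moreover have "nabla G (nabla G X Y) Z x
      = nabla G (\<lambda>_. ?DY) Z x + nabla G (\<lambda>_. christoffel G x (X x) (Y x)) Z x"
    using linear_add[OF linear_nabla[OF G x bspec[OF Z x]], of ?DY "christoffel G x (X x) (Y x)"]
    by (simp add: nabla_def)
  moreover have "nabla G Y Z x = nabla G (\<lambda>_. Y x) Z x" by (simp add: nabla_def)
  ultimately show ?thesis
    by (simp add: nabla2_def nabla_def[of G X "nabla G Y Z"])
qed

lemma linear_components: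
  fixes c :: "'e::euclidean_space \<Rightarrow> 'b::real_vector"
  shows "linear (\<lambda>v::'e. \<Sum>b\<in>Basis. (v \<bullet> b) *\<^sub>R c b)"
  by (rule linear_compose_sum, rule ballI, rule linearI)
     (simp_all only: inner_add_left scaleR_add_left inner_scaleR_left scaleR_scaleR real_scaleR_def)

lemma bilinear_nabla2:
  assumes G: "metric_near S G" and x: "x \<in> S"
    and Z: "\<forall>y\<in>S. Z differentiable (at y)"
    and Z2: "\<And>v. nabla G (\<lambda>_. v) Z differentiable (at x)"
  shows "bilinear (\<lambda>u v. nabla2 G (\<lambda>_. u) (\<lambda>_. v) Z x)"
proof -
  note N = nabla2_pointwise[OF G x Z Z2 differentiable_const]
  have c: "linear (\<lambda>u. christoffel G x u v)" "linear (\<lambda>v. christoffel G x u v)" for u v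
    using bilinear_christoffel[OF G x] by (simp_all add: bilinear_def)
  have l: "linear (\<lambda>v. nabla G (\<lambda>_. v) Z x)"
    by (rule linear_nabla[OF G x bspec[OF Z x]])
  show ?thesis
    unfolding bilinear_def N
    by (intro conjI allI linear_compose_add linear_compose_sub linear_components
          linear_frechet_derivative Z2 c
          linear_compose_sum ballI linear_compose_scale_right
          linear_compose[OF l c(2), unfolded o_def] linear_compose[OF c(1) l, unfolded o_def]
          linear_compose[OF c(2) l, unfolded o_def])
qed

text \<open>\<open>E\<close> is a local frame; only its orthonormality at \<open>x\<close> matters.\<close>
definition orthonormal_frame_at ::
    "('e::euclidean_space \<Rightarrow> 'e \<Rightarrow> 'e \<Rightarrow> real) \<Rightarrow> 'k set \<Rightarrow> ('k \<Rightarrow> 'e \<Rightarrow> 'e) \<Rightarrow> 'e \<Rightarrow> bool" where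
  "orthonormal_frame_at G K E x \<longleftrightarrow> inj_on (\<lambda>k. E k x) K \<and>
     orthonormal_basis (G x) ((\<lambda>k. E k x) ` K) \<and> (\<forall>k\<in>K. E k differentiable (at x))"

lemma metric_trace_frame:
  assumes "metric_near S G" "x \<in> S" "orthonormal_frame_at G K E x" "bilinear T"
  shows "metric_trace (G x) T = (\<Sum>k\<in>K. T (E k x) (E k x))"
proof -
  have "metric_trace (G x) T = (\<Sum>e\<in>(\<lambda>k. E k x) ` K. T e e)"
    using assms by (intro metric_trace_eq) (auto simp: metric_near_def orthonormal_frame_at_def)
  then show ?thesis
    using assms(3) by (simp add: sum.reindex orthonormal_frame_at_def)
qed

theorem rough_laplacian_frame:
  assumes G: "metric_near S G" and x: "x \<in> S"
    and Z: "\<forall>y\<in>S. Z differentiable (at y)"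
    and Z2: "\<And>v. nabla G (\<lambda>_. v) Z differentiable (at x)"
    and E: "orthonormal_frame_at G K E x"
  shows "rough_laplacian G Z x = - (\<Sum>k\<in>K. nabla2 G (E k) (E k) Z x)"
proof -
  have "nabla2 G (\<lambda>_. E k x) (\<lambda>_. E k x) Z x = nabla2 G (E k) (E k) Z x" if "k \<in> K" for k
  proof -
    have "E k differentiable (at x)" using E that by (simp add: orthonormal_frame_at_def)
    from nabla2_pointwise[OF G x Z Z2 this, of "E k"] show ?thesis
      by (simp only: nabla2_pointwise[OF G x Z Z2 differentiable_const])
  qed
  then show ?thesis
    unfolding rough_laplacian_def metric_trace_frame[OF G x E bilinear_nabla2[OF G x Z Z2]]
    by simp
qed

lemma nabla_bar_J_pointwise:
  assumes G: "metric_near S G" and x: "x \<in> S"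
    and \<xi>: "\<forall>y\<in>S. \<xi> differentiable (at y)"
    and \<xi>2: "\<And>v. nabla G (\<lambda>_. v) \<xi> differentiable (at x)"
    and lin: "\<forall>y\<in>S. linear (\<phi> y)"
    and \<phi>2: "\<And>v. (\<lambda>y. \<phi> y (nabla G (\<lambda>_. v) \<xi> y)) differentiable (at x)"
    and \<phi>\<xi>: "\<phi> x (\<xi> x) = 0" and \<eta>\<phi>: "\<And>v. G x (\<xi> x) (\<phi> x v) = 0"
    and Y: "Y differentiable (at x)"
  shows "nabla_bar_J G \<xi> \<phi> X (nabla G Y \<xi>) x =
    proj_D G \<xi> x ((\<Sum>b\<in>Basis. (Y x \<bullet> b) *\<^sub>R
         frechet_derivative (\<lambda>y. \<phi> y (nabla G (\<lambda>_. b) \<xi> y)) (at x) (X x))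
       + christoffel G x (X x) (\<phi> x (nabla G (\<lambda>_. Y x) \<xi> x)))
    - \<phi> x (proj_D G \<xi> x ((\<Sum>b\<in>Basis. (Y x \<bullet> b) *\<^sub>R
         frechet_derivative (nabla G (\<lambda>_. b) \<xi>) (at x) (X x))
       + christoffel G x (X x) (nabla G (\<lambda>_. Y x) \<xi> x)))"
proof -
  have S: "open S" using G by (simp add: metric_near_def)
  let ?DY = "frechet_derivative Y (at x) (X x)"
  have e: "nabla G Y \<xi> y = (\<Sum>b\<in>Basis. (Y y \<bullet> b) *\<^sub>R nabla G (\<lambda>_. b) \<xi> y)" if "y \<in> S" for y Y
    using nabla_components[OF G that bspec[OF \<xi> that]] .
  have e\<phi>: "\<phi> y (nabla G Y \<xi> y) = (\<Sum>b\<in>Basis. (Y y \<bullet> b) *\<^sub>R \<phi> y (nabla G (\<lambda>_. b) \<xi> y))"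
    if "y \<in> S" for y Y
    unfolding e[OF that, of Y] by (simp only: linear_sum[OF bspec[OF lin that]] linear_scale[OF bspec[OF lin that]])
  have d: "frechet_derivative (nabla G Y \<xi>) (at x) (X x) = nabla G (\<lambda>_. ?DY) \<xi> x
      + (\<Sum>b\<in>Basis. (Y x \<bullet> b) *\<^sub>R frechet_derivative (nabla G (\<lambda>_. b) \<xi>) (at x) (X x))"
    unfolding e[OF x, of "\<lambda>_. ?DY"]
    by (rule has_derivative_combination[OF S x, of "nabla G Y \<xi>" Y "\<lambda>b. nabla G (\<lambda>_. b) \<xi>", OF e Y \<xi>2])
  have d\<phi>: "frechet_derivative (\<lambda>y. \<phi> y (nabla G Y \<xi> y)) (at x) (X x) = \<phi> x (nabla G (\<lambda>_. ?DY) \<xi> x)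
      + (\<Sum>b\<in>Basis. (Y x \<bullet> b) *\<^sub>R
           frechet_derivative (\<lambda>y. \<phi> y (nabla G (\<lambda>_. b) \<xi> y)) (at x) (X x))"
    unfolding e\<phi>[OF x, of "\<lambda>_. ?DY"]
    by (rule has_derivative_combination[OF S x, of "\<lambda>y. \<phi> y (nabla G Y \<xi> y)" Y
          "\<lambda>b y. \<phi> y (nabla G (\<lambda>_. b) \<xi> y)", OF e\<phi> Y \<phi>2])
  have bG: "bilinear (G x)" using G x by (simp add: metric_near_def inner_form_def)
  have padd: "proj_D G \<xi> x (a + b) = proj_D G \<xi> x a + proj_D G \<xi> x b" for a b
    by (simp add: proj_D_def bilinear_radd[OF bG] scaleR_add_left)
  have p\<phi>: "proj_D G \<xi> x (\<phi> x a) = \<phi> x (proj_D G \<xi> x a)" for a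
    by (simp add: proj_D_def \<eta>\<phi> linear_diff[OF bspec[OF lin x]] linear_scale[OF bspec[OF lin x]] \<phi>\<xi>)
  have n: "nabla G Y \<xi> x = nabla G (\<lambda>_. Y x) \<xi> x" by (simp add: nabla_def)
  show ?thesis
    unfolding nabla_bar_J_def nabla_def[of G X] d d\<phi> n
    by (simp add: padd linear_add[OF bspec[OF lin x]] p\<phi> algebra_simps)
qed

theorem T_phi_frame:
  assumes G: "metric_near S G" and x: "x \<in> S"
    and \<xi>: "\<forall>y\<in>S. \<xi> differentiable (at y)"
    and \<xi>2: "\<And>v. nabla G (\<lambda>_. v) \<xi> differentiable (at x)"
    and lin: "\<forall>y\<in>S. linear (\<phi> y)"
    and \<phi>2: "\<And>v. (\<lambda>y. \<phi> y (nabla G (\<lambda>_. v) \<xi> y)) differentiable (at x)"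
    and \<phi>\<xi>: "\<phi> x (\<xi> x) = 0" and \<eta>\<phi>: "\<And>v. G x (\<xi> x) (\<phi> x v) = 0"
    and E: "orthonormal_frame_at G K E x"
  shows "T_phi G \<xi> \<phi> x = (\<Sum>k\<in>K. nabla_bar_J G \<xi> \<phi> (E k) (nabla G (E k) \<xi>) x)"
proof -
  note P = nabla_bar_J_pointwise[OF G x \<xi> \<xi>2 lin \<phi>2 \<phi>\<xi> \<eta>\<phi>]
  note N = P[OF differentiable_const]
  have bG: "bilinear (G x)" using G x by (simp add: metric_near_def inner_form_def)
  have p: "linear (proj_D G \<xi> x)"
    by (rule linearI)
       (auto simp: proj_D_def bilinear_radd[OF bG] bilinear_rmul[OF bG] algebra_simps)
  have c: "linear (\<lambda>u. christoffel G x u v)" "linear (\<lambda>v. christoffel G x u v)" for u v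
    using bilinear_christoffel[OF G x] by (simp_all add: bilinear_def)
  have l: "linear (\<lambda>v. nabla G (\<lambda>_. v) \<xi> x)"
    by (rule linear_nabla[OF G x bspec[OF \<xi> x]])
  have q: "linear (\<phi> x)" using lin x by blast
  have pq: "linear (\<lambda>v. \<phi> x (proj_D G \<xi> x v))"
    using linear_compose[OF p q] by (simp add: o_def)
  define P1 where "P1 u v = (\<Sum>b\<in>Basis. (v \<bullet> b) *\<^sub>R
         frechet_derivative (\<lambda>y. \<phi> y (nabla G (\<lambda>_. b) \<xi> y)) (at x) u)
       + christoffel G x u (\<phi> x (nabla G (\<lambda>_. v) \<xi> x))" for u v
  define P2 where "P2 u v = (\<Sum>b\<in>Basis. (v \<bullet> b) *\<^sub>R
         frechet_derivative (nabla G (\<lambda>_. b) \<xi>) (at x) u)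
       + christoffel G x u (nabla G (\<lambda>_. v) \<xi> x)" for u v
  have P1: "linear (\<lambda>u. P1 u v)" "linear (\<lambda>v. P1 u v)" for u v
    unfolding P1_def
    by (intro linear_compose_add linear_components linear_frechet_derivative \<phi>2 c
          linear_compose_sum ballI linear_compose_scale_right
          linear_compose[OF linear_compose[OF l q] c(2), unfolded o_def])+
  have P2: "linear (\<lambda>u. P2 u v)" "linear (\<lambda>v. P2 u v)" for u v
    unfolding P2_def
    by (intro linear_compose_add linear_components linear_frechet_derivative \<xi>2 c
          linear_compose_sum ballI linear_compose_scale_right
          linear_compose[OF l c(2), unfolded o_def])+
  have "bilinear (\<lambda>u v. nabla_bar_J G \<xi> \<phi> (\<lambda>_. u) (nabla G (\<lambda>_. v) \<xi>) x)"
    unfolding bilinear_def N P1_def[symmetric] P2_def[symmetric]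
    by (intro conjI allI linear_compose_sub
          linear_compose[OF P1(1) p, unfolded o_def] linear_compose[OF P1(2) p, unfolded o_def]
          linear_compose[OF P2(1) pq, unfolded o_def] linear_compose[OF P2(2) pq, unfolded o_def])
  note T = metric_trace_frame[OF G x E this]
  have "nabla_bar_J G \<xi> \<phi> (\<lambda>_. E k x) (nabla G (\<lambda>_. E k x) \<xi>) x
      = nabla_bar_J G \<xi> \<phi> (E k) (nabla G (E k) \<xi>) x" if "k \<in> K" for k
  proof -
    have "E k differentiable (at x)" using E that by (simp add: orthonormal_frame_at_def)
    from P[OF this, of "E k"] show ?thesis by (simp only: N)
  qed
  then show ?thesis unfolding T_phi_def T by simp
qed


subsection \<open>The almost contact metric structure of a warped product\<close>

lemma warped_almost_contact_metric:
  assumes M: "almost_hermitian_manifold M I U \<kappa> g J" and f: "\<forall>t. f t > 0"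
    and i: "i \<in> I" and y: "y \<in> line_times_chart \<kappa> i ` line_times_dom U i"
  defines "G \<equiv> warped_metric f g i y" and "\<phi> \<equiv> warped_phi J i y" and "\<xi> \<equiv> warped_reeb i y"
  shows "inner_form G" and "G \<xi> \<xi> = 1"
    and "\<phi> (\<phi> v) = - v + G \<xi> v *\<^sub>R \<xi>"
    and "G (\<phi> u) (\<phi> v) = G u v - G \<xi> u * G \<xi> v"
proof -
  obtain t x where yt: "y = (t, x)" and x: "x \<in> \<kappa> i ` U i"
    using y by (auto simp: line_times_chart_def line_times_dom_def)
  have "\<forall>i\<in>I. \<forall>x\<in>\<kappa> i ` U i. inner_form (g i x)"
    using M unfolding almost_hermitian_manifold_def riemannian_metric_def by (elim conjE)
  then have inn: "inner_form (g i x)" using i x by blast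
  then have bl: "bilinear (g i x)" and sym: "\<And>u v. g i x u v = g i x v u"
    and pos: "\<And>u. u \<noteq> 0 \<Longrightarrow> g i x u u > 0" by (auto simp: inner_form_def)
  have "\<forall>i\<in>I. \<forall>x\<in>\<kappa> i ` U i. \<forall>u v.
      J i x (J i x u) = - u \<and> g i x (J i x u) (J i x v) = g i x u v"
    using M unfolding almost_hermitian_manifold_def by (elim conjE)
  then have J: "J i x (J i x u) = - u" "g i x (J i x u) (J i x v) = g i x u v" for u v
    using i x by blast+
  have G: "G u v = fst u * fst v + (f t)\<^sup>2 * g i x (snd u) (snd v)" for u v
    by (simp add: G_def warped_metric_def yt split_beta)
  have \<phi>: "\<phi> u = (0, J i x (snd u))" for u
    by (simp add: \<phi>_def warped_phi_def yt split_beta)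
  have \<xi>: "\<xi> = (1, 0)" by (simp add: \<xi>_def warped_reeb_def)
  have \<eta>: "G \<xi> v = fst v" for v by (simp add: G \<xi> bilinear_lzero[OF bl])
  show "G \<xi> \<xi> = 1" unfolding \<eta> by (simp add: \<xi>)
  show "\<phi> (\<phi> v) = - v + G \<xi> v *\<^sub>R \<xi>" unfolding \<eta> by (simp add: \<phi> \<xi> J prod_eq_iff)
  show "G (\<phi> u) (\<phi> v) = G u v - G \<xi> u * G \<xi> v" by (simp only: \<eta>) (simp add: G \<phi> J)
  have f2: "(f t)\<^sup>2 > 0" using f by (simp add: less_imp_neq[symmetric])
  have "bilinear G"
    unfolding bilinear_def
    by (intro conjI allI linearI)
       (simp_all add: G bilinear_ladd[OF bl] bilinear_radd[OF bl] bilinear_lmul[OF bl]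
          bilinear_rmul[OF bl] algebra_simps)
  moreover have "G u v = G v u" for u v using sym by (simp add: G mult.commute)
  moreover have "G u u > 0" if "u \<noteq> 0" for u
  proof (cases "snd u = 0")
    case True
    then have "fst u \<noteq> 0" using that by (simp add: prod_eq_iff)
    then have "fst u * fst u > 0" by (auto simp: zero_less_mult_iff linorder_neq_iff)
    then show ?thesis using True by (simp add: G bilinear_lzero[OF bl])
  next
    case False
    then have "(f t)\<^sup>2 * g i x (snd u) (snd u) > 0" using pos f2 by simp
    then show ?thesis by (simp add: G add_nonneg_pos)
  qed
  ultimately show "inner_form G" by (simp add: inner_form_def)
qed

end

(* In the warped product, with h = f'/f, the Christoffel
   form of the chart R x V is
     Gamma((a,u),(b,v)) = (- f f' g(u,v), gamma(u,v) + h (a v + b u)).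
   Hence nabla_(b,v) xi = (0, h v), and the trace of nabla^2 xi is a multiple of xi
   cancelled by |nabla xi|^2 xi, which gives tau(xi) = 0. Similarly
   (nablabar_(a,u) J)(nabla_(b,v) xi) = (0, h (nabla_u J) v), because the terms containing h'
   commute with J and cancel; so T(phi) = (0, h f^-2 div J). Since div J is metrically dual to the codifferential of
   the Kaehler form, the first harmonic section equation says that f'(t) (div J)(x) = 0 for all t
   and x; the two factors depend on different variables. *)
theory Submission
  imports Defs
begin

section \<open>Derivatives, the tensor \<nabla>J and orthonormal bases in a chart\<close>

lemma nabla_germ:
  assumes D: "(Y' has_derivative D) (at x)" and S: "open S" "x \<in> S"
    and eq: "\<forall>y\<in>S. Y' y = Y y"
  shows "nabla G X Y x = D (X x) + christoffel G x (X x) (Y x)"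
proof -
  \<comment> \<open>Differentiation sees only the germ of a field, so a field given by a formula on
    the chart domain alone may be differentiated through that formula.\<close>
  have "(Y has_derivative D) (at x)"
    using has_derivative_transform_within_open[OF D S] eq by blast
  then show ?thesis unfolding nabla_def by (simp add: frechet_derivative_at[symmetric])
qed

lemma christoffel_eqI:
  assumes "metric_near S G" "x \<in> S" "bilinear B" "\<And>u v. B u v = B v u"
    and "\<And>u v w. frechet_derivative (\<lambda>y. G y v w) (at x) u = G x (B u v) w + G x v (B u w)"
  shows "christoffel G x = B"
  unfolding christoffel_def by (rule the1_equality[OF christoffel_ex1[OF assms(1,2)]]) (use assms in blast)

text \<open>Differentiating in \<open>y\<close> the identities that express linearity of
  \<open>A y\<close> gives the same identities for the derivative. They hold only for
  \<open>y\<close> in \<open>S\<close>, hence the passage through an open neighbourhood.\<close>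

lemma linear_frechet_derivative_family:
  assumes S: "open S" "x \<in> S" and lin: "\<And>y. y \<in> S \<Longrightarrow> linear (A y)"
    and d: "\<And>v. (\<lambda>y. A y v) differentiable (at x)"
  shows "linear (\<lambda>v. frechet_derivative (\<lambda>y. A y v) (at x) u)"
proof -
  have hd: "((\<lambda>y. A y v) has_derivative frechet_derivative (\<lambda>y. A y v) (at x)) (at x)" for v
    using d by (simp add: frechet_derivative_works[symmetric])
  have uniq: "frechet_derivative (\<lambda>y. A y v) (at x) u = D u"
    if "(h has_derivative D) (at x)" "\<And>y. y \<in> S \<Longrightarrow> h y = A y v" for h D v
    using frechet_derivative_at[OF has_derivative_transform_within_open[OF that(1) S that(2)]] by simp
  show ?thesis
  proof (rule linearI)
    show "frechet_derivative (\<lambda>y. A y (v + w)) (at x) u =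
        frechet_derivative (\<lambda>y. A y v) (at x) u + frechet_derivative (\<lambda>y. A y w) (at x) u" for v w
      by (rule uniq[OF has_derivative_add[OF hd hd]]) (simp add: linear_add[OF lin])
    show "frechet_derivative (\<lambda>y. A y (c *\<^sub>R v)) (at x) u =
        c *\<^sub>R frechet_derivative (\<lambda>y. A y v) (at x) u" for c v
      by (rule uniq[OF has_derivative_scaleR_right[OF hd]]) (simp add: linear_scale[OF lin])
  qed
qed

text \<open>The tensor \<open>(\<nabla>_u J) v\<close> at \<open>x\<close>, evaluated on the
  extensions of \<open>u\<close> and \<open>v\<close> with constant components.\<close>

definition nabla_J ::
    "('e::euclidean_space \<Rightarrow> 'e \<Rightarrow> 'e \<Rightarrow> real) \<Rightarrow> ('e \<Rightarrow> 'e \<Rightarrow> 'e) \<Rightarrow> 'e \<Rightarrow> 'e \<Rightarrow> 'e \<Rightarrow> 'e" where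
  "nabla_J G J x u v = nabla G (\<lambda>_. u) (\<lambda>y. J y v) x - J x (nabla G (\<lambda>_. u) (\<lambda>_. v) x)"

lemma nabla_const: "nabla G X (\<lambda>_. v) x = christoffel G x (X x) v"
  by (simp add: nabla_def)

lemma smooth_on_imp_differentiable:
  assumes "smooth_on S F" "x \<in> S"
  shows "F differentiable (at x)"
proof -
  have "higher_differentiable_on S F (Suc 0)" using assms(1) unfolding smooth_on_def by (rule spec)
  then show ?thesis using assms(2) by simp
qed

text \<open>At height \<open>t\<close> the warped length of a vertical vector is \<open>f t\<close>
  times its base length, so division by \<open>f t\<close> normalises; \<open>(1, 0)\<close> is the
  unit normal.\<close>

lemma orthonormal_basis_warped:
  assumes B: "orthonormal_basis (g i x) B" and bl: "bilinear (g i x)" and f: "f t > 0"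
  shows "orthonormal_basis (warped_metric f g i (t, x))
    (insert (1, 0) ((\<lambda>e. (0, (1 / f t) *\<^sub>R e)) ` B))"
proof -
  have on: "g i x u v = (if u = v then 1 else 0)" if "u \<in> B" "v \<in> B" for u v
    using B that by (auto simp: orthonormal_basis_def)
  let ?C = "insert (1, 0) ((\<lambda>e. (0::real, (1 / f t) *\<^sub>R e)) ` B)"
  let ?j = "\<lambda>u. (0::real, u)"
  have j: "linear ?j" by (rule linearI) auto
  have "?j e \<in> span ?C" if "e \<in> B" for e
  proof -
    have "f t *\<^sub>R (0::real, (1 / f t) *\<^sub>R e) \<in> span ?C"
      using that by (intro span_scale span_base) auto
    then show ?thesis using f by simp
  qed
  then have "span (?j ` B) \<subseteq> span ?C" by (intro span_minimal) auto
  then have V: "?j u \<in> span ?C" for u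
    using B unfolding linear_span_image[OF j] orthonormal_basis_def by auto
  have "(a, u) \<in> span ?C" for a u
  proof -
    have "a *\<^sub>R (1, 0) + ?j u \<in> span ?C" by (intro span_add span_scale V) (auto intro: span_base)
    then show ?thesis by simp
  qed
  then have "span ?C = UNIV" by auto
  then show ?thesis
    using on f unfolding orthonormal_basis_def warped_metric_def
    by (auto simp: bilinear_lzero[OF bl] bilinear_rzero[OF bl] bilinear_lmul[OF bl]
        bilinear_rmul[OF bl] power2_eq_square)
qed

lemma line_times_chart_image: "line_times_chart \<kappa> i ` line_times_dom U i = UNIV \<times> \<kappa> i ` U i"
  unfolding line_times_chart_def line_times_dom_def by (simp add: map_prod_surj_on)

section \<open>The base in one fixed chart: the derivative of \<open>J\<close> and the
  codifferential of the Kaehler form\<close>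

locale warped_almost_hermitian =
  fixes M :: "'a::{t2_space,second_countable_topology} set"
    and I :: "'i set" and U :: "'i \<Rightarrow> 'a set" and \<kappa> :: "'i \<Rightarrow> 'a \<Rightarrow> 'e::euclidean_space"
    and g :: "'i \<Rightarrow> 'e \<Rightarrow> 'e \<Rightarrow> 'e \<Rightarrow> real" and J :: "'i \<Rightarrow> 'e \<Rightarrow> 'e \<Rightarrow> 'e"
    and f :: "real \<Rightarrow> real" and i :: 'i
  assumes almost_hermitian: "almost_hermitian_manifold M I U \<kappa> g J"
    and smooth_f: "smooth_on UNIV f" and f_pos: "f t > 0"
    and chart: "i \<in> I"
begin

abbreviation "V \<equiv> \<kappa> i ` U i"
abbreviation "G \<equiv> warped_metric f g i"
abbreviation "\<xi> \<equiv> warped_reeb i :: real \<times> 'e \<Rightarrow> real \<times> 'e"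
abbreviation "\<phi> \<equiv> warped_phi J i"

definition h :: "real \<Rightarrow> real" where "h t = deriv f t / f t"

lemma base_metric_near: "metric_near V (g i)"
  using almost_hermitian chart unfolding almost_hermitian_manifold_def
  by (intro riemannian_metric_near) auto

lemma
  shows open_V: "open V"
    and g_differentiable: "x \<in> V \<Longrightarrow> (\<lambda>z. g i z u v) differentiable (at x)"
    and inner_form_g: "x \<in> V \<Longrightarrow> inner_form (g i x)"
    and bilinear_g: "x \<in> V \<Longrightarrow> bilinear (g i x)"
    and g_sym: "x \<in> V \<Longrightarrow> g i x u v = g i x v u"
  using base_metric_near by (auto simp: metric_near_def inner_form_def)

lemma J_field: "endomorphism_field I U \<kappa> J"
  using almost_hermitian unfolding almost_hermitian_manifold_def by (elim conjE)

lemma linear_J: "x \<in> V \<Longrightarrow> linear (J i x)"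
proof -
  have "\<forall>i\<in>I. \<forall>x\<in>\<kappa> i ` U i. linear (J i x)"
    using J_field unfolding endomorphism_field_def by (elim conjE)
  then show "x \<in> V \<Longrightarrow> linear (J i x)" using chart by blast
qed

lemma J_differentiable: "x \<in> V \<Longrightarrow> (\<lambda>y. J i y v) differentiable (at x)"
proof -
  have "\<forall>i\<in>I. \<forall>u. smooth_on (\<kappa> i ` U i) (\<lambda>x. J i x u)"
    using J_field unfolding endomorphism_field_def by (elim conjE)
  then show "x \<in> V \<Longrightarrow> (\<lambda>y. J i y v) differentiable (at x)"
    using chart smooth_on_imp_differentiable by blast
qed

lemma
  assumes x: "x \<in> V"
  shows J_J: "J i x (J i x u) = - u" and g_J_J: "g i x (J i x u) (J i x v) = g i x u v"
proof -
  have "\<forall>i\<in>I. \<forall>x\<in>\<kappa> i ` U i. \<forall>u v.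
      J i x (J i x u) = - u \<and> g i x (J i x u) (J i x v) = g i x u v"
    using almost_hermitian unfolding almost_hermitian_manifold_def by (elim conjE)
  then show "J i x (J i x u) = - u" "g i x (J i x u) (J i x v) = g i x u v"
    using x chart by blast+
qed

text \<open>An isometry with square -1 is skew: put \<open>J v\<close> for \<open>v\<close> in the
  Hermitian condition.\<close>

lemma g_J_skew: "x \<in> V \<Longrightarrow> g i x (J i x u) v = - g i x u (J i x v)"
  using g_J_J[of x u "J i x v"] by (simp add: J_J bilinear_rneg[OF bilinear_g])

text \<open>This makes the form traced in \<open>T_phi\<close> bilinear, so that an adapted basis
  may be used there. In the second slot the derivative term is linear because \<open>J\<close> is
  pointwise linear on all of \<open>V\<close>.\<close>

lemma bilinear_nabla_J:
  assumes x: "x \<in> V"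
  shows "bilinear (nabla_J (g i) (J i) x)"
proof -
  have c: "linear (\<lambda>u. christoffel (g i) x u v)" "linear (\<lambda>v. christoffel (g i) x u v)" for u v
    using bilinear_christoffel[OF base_metric_near x] by (simp_all add: bilinear_def)
  note J = linear_J[OF x]
  note d = linear_frechet_derivative[OF J_differentiable[OF x]]
    linear_frechet_derivative_family[OF open_V x linear_J J_differentiable[OF x]]
  show ?thesis
    unfolding bilinear_def nabla_J_def nabla_def
    by (intro conjI allI linear_compose_sub linear_compose_add d c
      linear_compose[OF J c(2), unfolded o_def]
      linear_compose[OF linear_compose_add[OF linear_frechet_derivative[OF differentiable_const] c(1)] J, unfolded o_def])
      (simp_all add: linear_compose[OF c(2) J, unfolded o_def])
qed

text \<open>The derivative of a skew endomorphism is skew: differentiate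
  \<open>g (J v) w = - g v (J w)\<close> along \<open>u\<close> by metric compatibility; the
  skewness of \<open>J\<close> itself turns the Christoffel terms into those of \<nabla>J.\<close>

lemma nabla_J_skew:
  assumes x: "x \<in> V"
  shows "g i x (nabla_J (g i) (J i) x u v) w = - g i x v (nabla_J (g i) (J i) x u w)"
proof -
  note bl = bilinear_g[OF x] and D = J_differentiable[OF x]
  note met = nabla_metric[OF base_metric_near x, of _ _ "\<lambda>_. u"]
  let ?F = "\<lambda>v w y. g i y v (J i y w)" and ?H = "\<lambda>v w y. g i y (J i y v) w"
  let ?\<gamma> = "christoffel (g i) x u"
  have F: "frechet_derivative (?F v w) (at x) u =
      g i x (?\<gamma> v) (J i x w) + g i x v (nabla (g i) (\<lambda>_. u) (\<lambda>y. J i y w) x)"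
    using met[of "\<lambda>_. v" "\<lambda>y. J i y w"] D by (simp add: nabla_const)
  have H: "frechet_derivative (?H v w) (at x) u =
      g i x (nabla (g i) (\<lambda>_. u) (\<lambda>y. J i y v) x) w + g i x (J i x v) (?\<gamma> w)"
    using met[of "\<lambda>y. J i y v" "\<lambda>_. w"] D by (simp add: nabla_const)
  have gF: "?H v w y = - ?F v w y" if "y \<in> V" for y using g_J_skew[OF that] .
  \<comment> \<open>Both the metric and its second argument vary with \<open>y\<close>. Expanding
    \<open>J w\<close> in the Euclidean basis leaves products of functions known to be
    differentiable.\<close>
  have "?F v w differentiable (at x)"
  proof -
    let ?S = "\<lambda>y. \<Sum>b\<in>Basis. (J i y w \<bullet> b) * g i y v b"
    have e: "?S y = ?F v w y" if "y \<in> V" for y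
    proof -
      have l: "linear (g i y v)" using bilinear_g[OF that] by (simp add: bilinear_def)
      have "?F v w y = g i y v (\<Sum>b\<in>Basis. (J i y w \<bullet> b) *\<^sub>R b)" by (simp add: euclidean_representation)
      then show ?thesis by (simp add: linear_sum[OF l] linear_scale[OF l])
    qed
    have "?S differentiable (at x)"
      using D g_differentiable[OF x]
      by (intro differentiable_sum differentiable_mult differentiable_inner) auto
    then show ?thesis
      unfolding differentiable_def
      using has_derivative_transform_within_open[OF _ open_V x, of ?S _ UNIV "?F v w"] e by blast
  qed
  then have "(?F v w has_derivative frechet_derivative (?F v w) (at x)) (at x)"
    by (simp add: frechet_derivative_works[symmetric])
  \<comment> \<open>Since \<open>?H = - ?F\<close> holds on the open set \<open>V\<close>, the two
    derivatives are opposite.\<close>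
  from has_derivative_transform_within_open[OF has_derivative_minus[OF this] open_V x, of "?H v w"]
  have "(?H v w has_derivative (\<lambda>u. - frechet_derivative (?F v w) (at x) u)) (at x)"
    using gF by simp
  from frechet_derivative_at[OF this]
  have "frechet_derivative (?H v w) (at x) u = - frechet_derivative (?F v w) (at x) u" by metis
  then show ?thesis
    unfolding F H nabla_J_def nabla_const
    by (simp add: bilinear_lsub[OF bl] bilinear_rsub[OF bl] g_J_skew[OF x])
qed

text \<open>As the metric is parallel, the derivative falls on \<open>J\<close> and gives
  \<open>g v ((\<nabla>_u J) w)\<close>. Skewness then moves \<nabla>J onto \<open>v\<close>, the
  slot that the codifferential traces against \<open>u\<close>.\<close>

lemma nabla_form_kaehler:
  assumes x: "x \<in> V"
  shows "nabla_form (g i) (kaehler_form g J i) (\<lambda>_. u) (\<lambda>_. v) (\<lambda>_. w) x =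
    - g i x (nabla_J (g i) (J i) x u v) w"
proof -
  have "frechet_derivative (\<lambda>y. g i y v (J i y w)) (at x) u =
      g i x (christoffel (g i) x u v) (J i x w) + g i x v (nabla (g i) (\<lambda>_. u) (\<lambda>y. J i y w) x)"
    using nabla_metric[OF base_metric_near x differentiable_const J_differentiable[OF x], where X = "\<lambda>_. u"]
    by (simp add: nabla_const)
  then have "nabla_form (g i) (kaehler_form g J i) (\<lambda>_. u) (\<lambda>_. v) (\<lambda>_. w) x =
      g i x v (nabla_J (g i) (J i) x u w)"
    unfolding nabla_form_def kaehler_form_def nabla_J_def nabla_const
    by (simp add: bilinear_rsub[OF bilinear_g[OF x]])
  then show ?thesis using nabla_J_skew[OF x] by simp
qed

definition div_J :: "'e \<Rightarrow> 'e" where "div_J x = metric_trace (g i x) (nabla_J (g i) (J i) x)"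

text \<open>The sign of the codifferential cancels the sign due to skewness. Both traces run over
  the same chosen basis, so linearity of the metric in its first slot suffices.\<close>

lemma codifferential_kaehler:
  assumes x: "x \<in> V"
  shows "codifferential (g i) (kaehler_form g J i) x w = g i x (div_J x) w"
proof -
  have l: "linear (\<lambda>z. g i x z w)" using bilinear_g[OF x] by (simp add: bilinear_def)
  show ?thesis
    unfolding codifferential_def nabla_form_kaehler[OF x] div_J_def metric_trace_def
    by (simp add: sum_negf linear_sum[OF l])
qed

text \<open>Positive definiteness: test with \<open>w = div_J x\<close>.\<close>

lemma div_J_eq_0_iff:
  assumes x: "x \<in> V"
  shows "div_J x = 0 \<longleftrightarrow> (\<forall>w. codifferential (g i) (kaehler_form g J i) x w = 0)"
  unfolding codifferential_kaehler[OF x]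
  using inner_form_g[OF x] bilinear_lzero[OF bilinear_g[OF x]]
  by (metis inner_form_def less_irrefl)

section \<open>Derivatives of the warping function\<close>

lemma f_DERIV: "(f has_real_derivative deriv f t) (at t)"
  using smooth_on_imp_differentiable[OF smooth_f, of t]
  by (simp add: DERIV_deriv_iff_real_differentiable)

lemma deriv_f_differentiable: "deriv f differentiable (at t)"
proof -
  \<comment> \<open>Order two of smoothness makes each directional derivative of \<open>f\<close>
    differentiable; in direction 1 this is \<open>deriv f\<close>.\<close>
  have "higher_differentiable_on UNIV f (Suc (Suc 0))" using smooth_f unfolding smooth_on_def by (rule spec)
  then have "(\<lambda>x. frechet_derivative f (at x) 1) differentiable (at t)" by simp
  moreover have "frechet_derivative f (at x) 1 = deriv f x" for x
    using frechet_derivative_at[OF f_DERIV[unfolded has_field_derivative_def], of x] by (metis mult.right_neutral)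
  ultimately show ?thesis by simp
qed

lemma h_DERIV: "(h has_real_derivative deriv h t) (at t)"
proof -
  have "h differentiable (at t)"
    unfolding h_def[abs_def]
    using deriv_f_differentiable smooth_on_imp_differentiable[OF smooth_f, of t] f_pos[of t]
    by (intro differentiable_divide) auto
  then show ?thesis by (simp add: DERIV_deriv_iff_real_differentiable)
qed

text \<open>Applied from right to left, this removes \<open>deriv f\<close> and leaves identities
  polynomial in \<open>f\<close> and \<open>h\<close>, without division.\<close>

lemma f_h: "f t * h t = deriv f t"
  using f_pos[of t] by (simp add: h_def)

section \<open>The Levi-Civita connection of the warped metric\<close>

lemma G_eq: "G y p q = fst p * fst q + (f (fst y))\<^sup>2 * g i (snd y) (snd p) (snd q)"
  by (simp add: warped_metric_def split_beta)

lemma G_has_derivative: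
  assumes x: "x \<in> V"
  shows "((\<lambda>y. G y p q) has_derivative (\<lambda>k. 2 * f t * deriv f t * fst k * g i x (snd p) (snd q)
     + (f t)\<^sup>2 * frechet_derivative (\<lambda>z. g i z (snd p) (snd q)) (at x) (snd k))) (at (t, x))"
proof -
  have d: "((\<lambda>z. g i z (snd p) (snd q)) has_derivative
      frechet_derivative (\<lambda>z. g i z (snd p) (snd q)) (at x)) (at x)"
    using g_differentiable[OF x] by (simp add: frechet_derivative_works[symmetric])
  have f: "(f has_derivative (\<lambda>k. deriv f t * k)) (at t)"
    using f_DERIV by (simp add: has_field_derivative_def)
  have f1: "((\<lambda>y. f (fst y)) has_derivative (\<lambda>k. deriv f t * fst k)) (at (t, x))"
    by (rule has_derivative_compose[OF has_derivative_fst[OF has_derivative_ident], of f]) (use f in simp)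
  have d1: "((\<lambda>y. g i (snd y) (snd p) (snd q)) has_derivative
      (\<lambda>k. frechet_derivative (\<lambda>z. g i z (snd p) (snd q)) (at x) (snd k))) (at (t, x))"
    by (rule has_derivative_compose[OF has_derivative_snd[OF has_derivative_ident]]) (use d in simp)
  show ?thesis
    unfolding G_eq power2_eq_square
    by (rule has_derivative_eq_rhs[OF has_derivative_add[OF has_derivative_const
          has_derivative_mult[OF has_derivative_mult[OF f1 f1] d1]]])
       (auto simp: fun_eq_iff algebra_simps)
qed

lemma warped_metric_near: "metric_near (UNIV \<times> V) G"
  unfolding metric_near_def
proof (intro conjI allI ballI)
  show "open (UNIV \<times> V)" using open_V by (simp add: open_Times)
  show "inner_form (G y)" if "y \<in> UNIV \<times> V" for y
    using warped_almost_contact_metric(1)[OF almost_hermitian _ chart] f_pos that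
    unfolding line_times_chart_image by blast
  show "(\<lambda>z. G z u v) differentiable (at y)" if "y \<in> UNIV \<times> V" for u v y
    using G_has_derivative that unfolding differentiable_def by (cases y) blast
qed

lemma christoffel_warped:
  assumes x: "x \<in> V"
  shows "christoffel G (t, x) p q = (- f t * deriv f t * g i x (snd p) (snd q),
    christoffel (g i) x (snd p) (snd q) + h t *\<^sub>R (fst p *\<^sub>R snd q + fst q *\<^sub>R snd p))"
proof -
  note bl = bilinear_g[OF x]
  note bc = bilinear_christoffel[OF base_metric_near x]
  note ll = bilinear_ladd bilinear_radd bilinear_lmul bilinear_rmul
  have "christoffel G (t, x) = (\<lambda>p q. (- f t * deriv f t * g i x (snd p) (snd q),
    christoffel (g i) x (snd p) (snd q) + h t *\<^sub>R (fst p *\<^sub>R snd q + fst q *\<^sub>R snd p)))" (is "_ = ?B")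
  \<comment> \<open>The formula is verified, not derived: a symmetric bilinear map compatible with
    the metric is the Christoffel map.\<close>
  proof (rule christoffel_eqI[OF warped_metric_near])
    show "(t, x) \<in> UNIV \<times> V" using x by simp
    show "bilinear ?B"
      unfolding bilinear_def
      by (intro conjI allI linearI) (simp_all add: ll[OF bl] ll[OF bc] algebra_simps)
    show "?B u v = ?B v u" for u v
      using g_sym[OF x] christoffel_sym[OF base_metric_near x] by (simp add: add.commute)
    fix u v w :: "real \<times> 'e"
    let ?\<gamma> = "christoffel (g i) x (snd u)"
    have "frechet_derivative (\<lambda>y. G y v w) (at (t, x)) u =
        2 * f t * deriv f t * fst u * g i x (snd v) (snd w)
        + (f t)\<^sup>2 * (g i x (?\<gamma> (snd v)) (snd w) + g i x (snd v) (?\<gamma> (snd w)))"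
      unfolding frechet_derivative_at[OF G_has_derivative[OF x], symmetric]
        christoffel_metric[OF base_metric_near x] ..
    \<comment> \<open>As \<open>f^2 h = f f'\<close>, the terms with \<open>fst v\<close> and those
      with \<open>fst w\<close> cancel, the latter by symmetry of \<open>g\<close>; the two terms
      with \<open>fst u\<close> add up to the factor \<open>2 f f'\<close>.\<close>
    also have "\<dots> = G (t, x) (?B u v) w + G (t, x) v (?B u w)"
      using g_sym[OF x, of "snd u" "snd v"]
      by (simp add: G_eq f_h[symmetric] ll[OF bl] algebra_simps power2_eq_square)
    finally show "frechet_derivative (\<lambda>y. G y v w) (at (t, x)) u = G (t, x) (?B u v) w + G (t, x) v (?B u w)" .
  qed
  then show ?thesis by simp
qed

section \<open>First and second derivatives of the Reeb field\<close>

lemma nabla_reeb: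
  assumes "snd y \<in> V"
  shows "nabla G X \<xi> y = (0, h (fst y) *\<^sub>R snd (X y))"
proof -
  have "christoffel (g i) (snd y) u 0 = 0" for u
    using bilinear_rzero[OF bilinear_christoffel[OF base_metric_near assms]] .
  \<comment> \<open>The Reeb field has constant components, so only the Christoffel term remains.
    \<open>X\<close> is arbitrary because \<open>nabla2\<close> also differentiates along the field
    \<open>nabla G X Y\<close>.\<close>
  then show ?thesis
    using christoffel_warped[OF assms, of "fst y" "X y" "(1, 0)"]
    by (simp add: warped_reeb_def nabla_const bilinear_rzero[OF bilinear_g[OF assms]])
qed

text \<open>One computation for both \<open>\<nabla>\<xi>\<close>, with \<open>Z\<close> constant,
  and \<open>J \<nabla>\<xi>\<close>, with \<open>Z = J v\<close>. In \<open>h' + h^2\<close> the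
  first summand comes from differentiating the factor \<open>h\<close>, the second from the mixed
  Christoffel term; the first component uses \<open>f f' h = f'^2\<close>.\<close>

lemma nabla_vertical:
  assumes x: "x \<in> V" and Z: "(Z has_derivative Z') (at x)"
    and Y: "\<forall>y\<in>UNIV \<times> V. Y y = (0, h (fst y) *\<^sub>R Z (snd y))"
  shows "nabla G (\<lambda>_. p) Y (t, x) = (- (deriv f t)\<^sup>2 * g i x (snd p) (Z x),
    h t *\<^sub>R (Z' (snd p) + christoffel (g i) x (snd p) (Z x))
    + (fst p * (deriv h t + (h t)\<^sup>2)) *\<^sub>R Z x)"
proof -
  have h: "(h has_derivative (\<lambda>k. deriv h t * k)) (at t)"
    using h_DERIV by (simp add: has_field_derivative_def)
  have h1: "((\<lambda>y. h (fst y)) has_derivative (\<lambda>k. deriv h t * fst k)) (at (t, x))"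
    by (rule has_derivative_compose[OF has_derivative_fst[OF has_derivative_ident], of h]) (use h in simp)
  have Z1: "((\<lambda>y. Z (snd y)) has_derivative (\<lambda>k. Z' (snd k))) (at (t, x))"
    by (rule has_derivative_compose[OF has_derivative_snd[OF has_derivative_ident], of Z]) (use Z in simp)
  have S: "open (UNIV \<times> V :: (real \<times> 'e) set)" "(t, x) \<in> UNIV \<times> V"
    using open_V x by (auto simp: open_Times)
  have eq: "\<forall>y\<in>UNIV \<times> V. (0, h (fst y) *\<^sub>R Z (snd y)) = Y y" using Y by simp
  show ?thesis
    unfolding nabla_germ[OF has_derivative_Pair[OF has_derivative_const has_derivative_scaleR[OF h1 Z1]] S eq]
      christoffel_warped[OF x]
    using x by (simp add: Y f_h[symmetric] bilinear_rmul[OF bilinear_g[OF x]]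
        bilinear_rmul[OF bilinear_christoffel[OF base_metric_near x]] algebra_simps power2_eq_square)
qed

lemma nabla_nabla_reeb:
  assumes x: "x \<in> V"
  shows "nabla G (\<lambda>_. p) (nabla G (\<lambda>_. q) \<xi>) (t, x) = (- (deriv f t)\<^sup>2 * g i x (snd p) (snd q),
    h t *\<^sub>R christoffel (g i) x (snd p) (snd q) + (fst p * (deriv h t + (h t)\<^sup>2)) *\<^sub>R snd q)"
proof -
  have "\<forall>y\<in>UNIV \<times> V. nabla G (\<lambda>_. q) \<xi> y = (0, h (fst y) *\<^sub>R snd q)" using nabla_reeb by auto
  from nabla_vertical[OF x has_derivative_const this] show ?thesis by simp
qed

text \<open>The base Christoffel symbols cancel. For \<open>p = q\<close> equal to
  \<open>(1, 0)\<close> or to some \<open>(0, u)\<close> the second component vanishes, which leaves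
  a trace along \<open>\<xi>\<close> only.\<close>

lemma nabla2_reeb:
  assumes x: "x \<in> V"
  shows "nabla2 G (\<lambda>_. p) (\<lambda>_. q) \<xi> (t, x) = (- (deriv f t)\<^sup>2 * g i x (snd p) (snd q),
    (deriv h t * fst p) *\<^sub>R snd q - ((h t)\<^sup>2 * fst q) *\<^sub>R snd p)"
  unfolding nabla2_def nabla_nabla_reeb[OF x]
  using x by (simp add: nabla_reeb nabla_const christoffel_warped algebra_simps power2_eq_square)

lemma nabla_bar_J_warped:
  assumes x: "x \<in> V"
  shows "nabla_bar_J G \<xi> \<phi> (\<lambda>_. p) (nabla G (\<lambda>_. q) \<xi>) (t, x) =
    (0, h t *\<^sub>R nabla_J (g i) (J i) x (snd p) (snd q))"
proof -
  have dJ: "((\<lambda>y. J i y (snd q)) has_derivative frechet_derivative (\<lambda>y. J i y (snd q)) (at x)) (at x)"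
    using J_differentiable[OF x] by (simp add: frechet_derivative_works[symmetric])
  have \<phi>: "\<forall>y\<in>UNIV \<times> V. \<phi> y (nabla G (\<lambda>_. q) \<xi> y) = (0, h (fst y) *\<^sub>R J i (snd y) (snd q))"
    by (auto simp: nabla_reeb warped_phi_def linear_scale[OF linear_J])
  \<comment> \<open>Projection to the vertical part discards the components \<open>- f'^2 g\<close>
    of the second derivatives.\<close>
  have p: "proj_D G \<xi> (t, x) k = (0, snd k)" for k
    by (cases k) (simp add: proj_D_def warped_reeb_def G_eq bilinear_lzero[OF bilinear_g[OF x]])
  show ?thesis
    unfolding nabla_bar_J_def p
      nabla_vertical[where Y = "\<lambda>y. \<phi> y (nabla G (\<lambda>_. q) \<xi> y)", OF x dJ \<phi>] nabla_nabla_reeb[OF x]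
    by (simp add: warped_phi_def nabla_J_def nabla_def[of "g i"] linear_add[OF linear_J[OF x]]
        linear_scale[OF linear_J[OF x]] algebra_simps)
qed

section \<open>Traces: \<open>tau\<close>, \<open>T_phi\<close> and the section equation at a
  point\<close>

lemma metric_trace_warped:
  assumes x: "x \<in> V" and T: "bilinear T"
  shows "metric_trace (G (t, x)) T =
    T (1, 0) (1, 0) + (1 / (f t)\<^sup>2) *\<^sub>R metric_trace (g i x) (\<lambda>u v. T (0, u) (0, v))"
proof -
  obtain B where B: "orthonormal_basis (g i x) B"
    using orthonormal_basis_exists[OF inner_form_g[OF x]] by blast
  have fin: "finite B" using orthonormal_basis_finite[OF inner_form_g[OF x] B] .
  have iG: "inner_form (G (t, x))" using warped_metric_near x unfolding metric_near_def by blast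
  have f0: "f t \<noteq> 0" using f_pos[of t] by simp
  have l: "linear (\<lambda>u. T u v)" "linear (T u)" for u v using T unfolding bilinear_def by blast+
  have j: "linear (\<lambda>u::'e. (0::real, u))" by (rule linearI) auto
  have T0: "bilinear (\<lambda>u v. T (0, u) (0, v))"
    unfolding bilinear_def
    by (intro conjI allI linear_compose[OF j l(1), unfolded o_def] linear_compose[OF j l(2), unfolded o_def])
  \<comment> \<open>The factor \<open>1 / f t\<close> of a vertical basis vector enters through both
    slots; this is the source of \<open>1 / (f t)^2\<close>.\<close>
  have sc: "T (0, c *\<^sub>R u) (0, c *\<^sub>R u) = (c * c) *\<^sub>R T (0, u) (0, u)" for c u
    using bilinear_lmul[OF T0] bilinear_rmul[OF T0] by simp
  have "metric_trace (G (t, x)) T = T (1, 0) (1, 0)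
      + (\<Sum>e\<in>B. T (0, (1 / f t) *\<^sub>R e) (0, (1 / f t) *\<^sub>R e))"
    unfolding metric_trace_eq[OF iG orthonormal_basis_warped[where f = f and g = g, OF B bilinear_g[OF x] f_pos] T]
    using fin f0 by (subst sum.insert) (auto simp: sum.reindex inj_on_def)
  then show ?thesis
    unfolding metric_trace_eq[OF inner_form_g[OF x] B T0] sc
    by (simp add: scaleR_sum_right power2_eq_square)
qed

lemma tau_reeb:
  assumes x: "x \<in> V"
  shows "tau G \<xi> (t, x) = 0"
proof -
  note bl = bilinear_g[OF x]
  note ll = bilinear_ladd[OF bl] bilinear_radd[OF bl] bilinear_lmul[OF bl] bilinear_rmul[OF bl]
  \<comment> \<open>The trace of the metric against itself, that is, the dimension of the base; it
    stays symbolic because it is a common factor of both terms of \<open>tau\<close>.\<close>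
  let ?r = "metric_trace (g i x) (g i x)"
  have f0: "f t \<noteq> 0" using f_pos[of t] by simp
  have b1: "bilinear (\<lambda>p q. nabla2 G (\<lambda>_. p) (\<lambda>_. q) \<xi> (t, x))"
    unfolding bilinear_def nabla2_reeb[OF x]
    by (intro conjI allI linearI) (simp_all add: ll algebra_simps)
  have b2: "bilinear (\<lambda>p q. G (t, x) (nabla G (\<lambda>_. p) \<xi> (t, x)) (nabla G (\<lambda>_. q) \<xi> (t, x)))"
    unfolding bilinear_def using x
    by (intro conjI allI linearI) (simp_all add: nabla_reeb G_eq ll algebra_simps)
  have t1: "metric_trace (g i x) (\<lambda>u v. (c * g i x u v, 0::'e)) = (c * ?r, 0)" for c
    by (simp add: metric_trace_def sum_prod sum_distrib_left)
  have t2: "metric_trace (g i x) (\<lambda>u v. c * g i x u v) = c * ?r" for c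
    by (simp add: metric_trace_def sum_distrib_left)
  \<comment> \<open>Here \<open>f'^2\<close> from the second derivative, and in the norm below
    \<open>(f h)^2\<close> from the metric, is divided by the \<open>f^2\<close> of the trace; both
    quotients are \<open>h^2\<close>.\<close>
  have "rough_laplacian G \<xi> (t, x) = ((h t)\<^sup>2 * ?r, 0)"
    unfolding rough_laplacian_def metric_trace_warped[OF x b1]
    unfolding nabla2_reeb[OF x]
    using t1[of "- (deriv f t)\<^sup>2"] f0
    by (simp add: bilinear_lzero[OF bl] h_def power_divide)
  moreover have "nabla_norm_sq G \<xi> (t, x) = (h t)\<^sup>2 * ?r"
    unfolding nabla_norm_sq_def metric_trace_warped[OF x b2]
    using x f0 t2[of "(f t * h t)\<^sup>2"]
    by (simp add: nabla_reeb G_eq bilinear_lzero[OF bl] ll power2_eq_square ac_simps)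
  ultimately show ?thesis by (simp add: tau_def warped_reeb_def)
qed

lemma T_phi_warped:
  assumes x: "x \<in> V"
  shows "T_phi G \<xi> \<phi> (t, x) = (0, (h t / (f t)\<^sup>2) *\<^sub>R div_J x)"
proof -
  note bl = bilinear_nabla_J[OF x]
  note ll = bilinear_ladd[OF bl] bilinear_radd[OF bl] bilinear_lmul[OF bl] bilinear_rmul[OF bl]
  have b: "bilinear (\<lambda>p q. nabla_bar_J G \<xi> \<phi> (\<lambda>_. p) (nabla G (\<lambda>_. q) \<xi>) (t, x))"
    unfolding bilinear_def nabla_bar_J_warped[OF x]
    by (intro conjI allI linearI) (simp_all add: ll algebra_simps)
  have "metric_trace (g i x) (\<lambda>u v. (0::real, h t *\<^sub>R nabla_J (g i) (J i) x u v)) = (0, h t *\<^sub>R div_J x)"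
    by (simp add: metric_trace_def div_J_def sum_prod scaleR_sum_right)
  then show ?thesis
    unfolding T_phi_def metric_trace_warped[OF x b]
    unfolding nabla_bar_J_warped[OF x]
    by (simp add: bilinear_lzero[OF bl])
qed

text \<open>With \<open>tau\<close> zero, the equation says that \<open>J\<close> kills a multiple
  of \<open>div_J x\<close>. \<open>J\<close> is injective because its square is -1, and the
  multiple vanishes exactly when \<open>deriv f t\<close> does.\<close>

lemma first_harmonic_section_eq_at_iff:
  assumes x: "x \<in> V"
  shows "tau G \<xi> (t, x) + (1/2) *\<^sub>R \<phi> (t, x) (T_phi G \<xi> \<phi> (t, x)) = 0 \<longleftrightarrow>
    deriv f t = 0 \<or> div_J x = 0"
proof -
  have "J i x v = 0 \<longleftrightarrow> v = 0" for v
    using J_J[OF x, of v] linear_0[OF linear_J[OF x]] by force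
  then show ?thesis
    unfolding tau_reeb[OF x] T_phi_warped[OF x] using f_pos[of t]
    by (simp add: warped_phi_def h_def zero_prod_def)
qed

end

section \<open>From the charts to the manifold\<close>

theorem proposition3p3:
  fixes M :: "'a::{t2_space,second_countable_topology} set"
    and I :: "'i set" and U :: "'i \<Rightarrow> 'a set" and \<kappa> :: "'i \<Rightarrow> 'a \<Rightarrow> 'e::euclidean_space"
    and g :: "'i \<Rightarrow> 'e \<Rightarrow> 'e \<Rightarrow> 'e \<Rightarrow> real" and J :: "'i \<Rightarrow> 'e \<Rightarrow> 'e \<Rightarrow> 'e"
    and f :: "real \<Rightarrow> real" and n :: nat
  assumes "DIM('e) = 2 * n"
    and "almost_hermitian_manifold M I U \<kappa> g J"
    and "smooth_on UNIV f" and "\<forall>t. f t > 0"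
  shows "harmonic_unit_field I (line_times_dom U) (line_times_chart \<kappa>)
           (warped_metric f g) warped_reeb \<and>
         (first_harmonic_section_eq I (line_times_dom U) (line_times_chart \<kappa>)
            (warped_metric f g) warped_reeb (warped_phi J)
          \<longleftrightarrow> cosymplectic I U \<kappa> g J \<or> f constant_on UNIV)"
proof -
  have w: "warped_almost_hermitian M I U \<kappa> g J f i" if "i \<in> I" for i
    using assms that by unfold_locales auto
  have "harmonic_unit_field I (line_times_dom U) (line_times_chart \<kappa>) (warped_metric f g) warped_reeb"
    unfolding harmonic_unit_field_def line_times_chart_image using warped_almost_hermitian.tau_reeb[OF w] by blast
  moreover have "first_harmonic_section_eq I (line_times_dom U) (line_times_chart \<kappa>)
      (warped_metric f g) warped_reeb (warped_phi J) \<longleftrightarrow>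
      (\<forall>i\<in>I. \<forall>x\<in>\<kappa> i ` U i. \<forall>t. deriv f t = 0 \<or>
         (\<forall>v. codifferential (g i) (kaehler_form g J i) x v = 0))"
    unfolding first_harmonic_section_eq_def line_times_chart_image
    using warped_almost_hermitian.first_harmonic_section_eq_at_iff[OF w]
      warped_almost_hermitian.div_J_eq_0_iff[OF w] by (simp add: Ball_def) blast
  moreover have "(\<forall>t. deriv f t = 0) \<longleftrightarrow> f constant_on UNIV"
  proof
    assume "\<forall>t. deriv f t = 0"
    \<comment> \<open>A value of \<open>deriv\<close> is a genuine derivative only where
      \<open>f\<close> is differentiable, which smoothness supplies.\<close>
    then have "(f has_real_derivative 0) (at t)" for t
      using smooth_on_imp_differentiable[OF assms(3), of t]
      by (metis DERIV_deriv_iff_real_differentiable UNIV_I)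
    then show "f constant_on UNIV" by (metis DERIV_isconst_all constant_on_def)
  next
    assume "f constant_on UNIV"
    then obtain c where "f = (\<lambda>_. c)" by (auto simp: constant_on_def)
    then show "\<forall>t. deriv f t = 0" by simp
  qed
  \<comment> \<open>\<open>t\<close> varies independently of the chart and the base point, so the
    quantified disjunction splits into a disjunction of two universal statements.\<close>
  ultimately show ?thesis unfolding cosymplectic_def by blast
qed

end
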